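(* For $\xi>0$ and $k\in\mathbb N=\{1,2,\ldots\}$ let $p_k(\xi):=\mathrm P(V_k=0\mid V_0=0)$. Then for every $k\in\mathbb N$, $$p_k(\xi)=\sum_{\ell=0}^{k-1}\frac{(-\xi)^\ell}{\ell!}\,p_1^{(\ell)}(\xi),$$ where $p_1^{(\ell)}$ denotes the $\ell$-th derivative of $\xi\mapsto p_1(\xi)$ and $$p_1^{(\ell)}(\xi)=\xi\,\varrho_\ell(\xi)+\ell\,\varrho_{\ell-1}(\xi),\qquad \varrho_\ell(\xi):=\frac{\mathrm d^\ell}{\mathrm d\xi^\ell}\left(\frac1{\psi(\xi)}\right)$$ (for $\ell=0$ the second term is $0$). In addition, for $\ell\ge1$, $\varrho_\ell(\xi)$ can be found recursively from $$\varrho_\ell(\xi)=-\frac1{\psi(\xi)}\sum_{m=0}^{\ell-1}\binom{\ell}{m}\varrho_m(\xi)\,\psi^{(\ell-m)}(\xi).$$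
   Context: $J(\cdot)$ is a non-decreasing pure-jump Lévy process (driftless subordinator) with Lévy measure $\nu$ on $(0,\infty)$, and $X(t)=J(t)-t$. Its Laplace exponent is $\varphi(\alpha):=\log\mathrm E\,e^{-\alpha X(1)}=\alpha-\int_{(0,\infty)}(1-e^{-\alpha x})\,\nu(\mathrm dx)$, $\alpha\ge0$. For $\xi>0$, $\psi(\xi)$ denotes the unique positive solution of $\varphi(\psi(\xi))=\xi$ (the inverse of $\varphi$), and $\psi^{(j)}$ its $j$-th derivative. The workload process is $V(t)=X(t)+\max\{V(0),L(t)\}$ with $L(t):=-\inf_{0\le s\le t}X(s)$. It is sampled at the epochs $S_k=T_1+\cdots+T_k$ of an independent Poisson process of rate $\xi$ (the $T_i$ are i.i.d. exponential with mean $1/\xi$, independent of $J$ and $V(0)$); $V_k:=V(S_k)$, $V_0:=V(0)$. *)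

theory Defs
  imports "HOL-Probability.Probability"
begin

definition path :: "(real \<Rightarrow> 'a \<Rightarrow> real) \<Rightarrow> 'a \<Rightarrow> real \<Rightarrow> real" where
  "path J \<omega> = (\<lambda>t\<in>{0..}. J t \<omega>)"

abbreviation path_space :: "(real \<Rightarrow> real) measure" where
  "path_space \<equiv> Pi\<^sub>M {0..} (\<lambda>_. borel)"

text \<open>
  Path properties are required for every outcome, not just almost surely, so that events such as
  \<open>V(t) = 0\<close>, which involve an infimum over an uncountable set of times, are measurable even if
  the probability space is not complete.
\<close>

locale levy_process = prob_space M for M :: "'a measure" +
  fixes J :: "real \<Rightarrow> 'a \<Rightarrow> real"
  assumes random_variable_at: "0 \<le> t \<Longrightarrow> J t \<in> borel_measurable M"
    and start: "\<omega> \<in> space M \<Longrightarrow> J 0 \<omega> = 0"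
    and indep_increments: "\<And>(\<tau> :: nat \<Rightarrow> real) n. 0 \<le> \<tau> 0 \<Longrightarrow> mono \<tau> \<Longrightarrow>
          indep_vars (\<lambda>_. borel) (\<lambda>i \<omega>. J (\<tau> (Suc i)) \<omega> - J (\<tau> i) \<omega>) {..<n}"
    and stationary_increments: "0 \<le> s \<Longrightarrow> 0 \<le> t \<Longrightarrow>
          distr M borel (\<lambda>\<omega>. J (s + t) \<omega> - J s \<omega>) = distr M borel (J t)"
    and right_continuous: "\<omega> \<in> space M \<Longrightarrow> 0 \<le> t \<Longrightarrow> continuous (at_right t) (\<lambda>s. J s \<omega>)"
    and left_limits: "\<omega> \<in> space M \<Longrightarrow> 0 < t \<Longrightarrow> \<exists>l. ((\<lambda>s. J s \<omega>) \<longlongrightarrow> l) (at_left t)"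

text \<open>
  The absence of a drift and the Levy measure are expressed through the Levy-Khintchine formula:
  the Laplace exponent of a general subordinator has an additional drift term \<open>d * \<alpha>\<close>.
\<close>

locale pure_jump_subordinator = levy_process M J
  for M :: "'a measure" and J :: "real \<Rightarrow> 'a \<Rightarrow> real" +
  fixes \<nu> :: "real measure"
  assumes nondecreasing: "\<omega> \<in> space M \<Longrightarrow> mono_on {0..} (\<lambda>t. J t \<omega>)"
    and sets_levy_measure: "sets \<nu> = sets borel"
    and levy_measure_pos: "emeasure \<nu> {..0} = 0"
    and levy_measure_finite: "(\<integral>\<^sup>+ x. ennreal (min 1 x) \<partial>\<nu>) < \<infinity>"
    and levy_khintchine: "0 \<le> \<alpha> \<Longrightarrow>
          expectation (\<lambda>\<omega>. exp (- \<alpha> * J 1 \<omega>)) = exp (- (\<integral>x. 1 - exp (- \<alpha> * x) \<partial>\<nu>))"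

text \<open>
  \<open>V0\<close> is the initial workload and \<open>T \<xi> i\<close>, for \<open>i \<ge> 1\<close>, are the times between the sampling epochs
  when the sampling rate is \<open>\<xi>\<close>. Nothing is assumed about the joint law of \<open>T \<xi>\<close> and \<open>T \<xi>'\<close>
  for different rates.
\<close>

locale sampled_workload = pure_jump_subordinator M J \<nu>
  for M :: "'a measure" and J :: "real \<Rightarrow> 'a \<Rightarrow> real" and \<nu> :: "real measure" +
  fixes V0 :: "'a \<Rightarrow> real" and T :: "real \<Rightarrow> nat \<Rightarrow> 'a \<Rightarrow> real"
  assumes initial_measurable: "V0 \<in> borel_measurable M"
    and initial_nonneg: "\<omega> \<in> space M \<Longrightarrow> 0 \<le> V0 \<omega>"
    and initial_indep: "indep_set
          (sets (vimage_algebra (space M) (path J) path_space))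
          (sets (vimage_algebra (space M) V0 borel))"
    and times_pos: "0 < \<xi> \<Longrightarrow> 1 \<le> i \<Longrightarrow> \<omega> \<in> space M \<Longrightarrow> 0 < T \<xi> i \<omega>"
    and times_exponential: "0 < \<xi> \<Longrightarrow> 1 \<le> i \<Longrightarrow>
          distributed M lborel (T \<xi> i) (exponential_density \<xi>)"
    and times_iid: "0 < \<xi> \<Longrightarrow> indep_vars (\<lambda>_. borel) (T \<xi>) {1..}"
    and times_indep: "0 < \<xi> \<Longrightarrow> indep_set
          (sets (vimage_algebra (space M) (\<lambda>\<omega>. (path J \<omega>, V0 \<omega>)) (path_space \<Otimes>\<^sub>M borel)))
          (sets (vimage_algebra (space M) (\<lambda>\<omega>. \<lambda>i\<in>{1..}. T \<xi> i \<omega>) (Pi\<^sub>M {1..} (\<lambda>_. borel))))"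

definition net_input :: "(real \<Rightarrow> 'a \<Rightarrow> real) \<Rightarrow> real \<Rightarrow> 'a \<Rightarrow> real" where
  "net_input J t \<omega> = J t \<omega> - t"

definition regulator :: "(real \<Rightarrow> 'a \<Rightarrow> real) \<Rightarrow> real \<Rightarrow> 'a \<Rightarrow> real" where
  "regulator J t \<omega> = - (INF s\<in>{0..t}. net_input J s \<omega>)"

definition workload :: "(real \<Rightarrow> 'a \<Rightarrow> real) \<Rightarrow> ('a \<Rightarrow> real) \<Rightarrow> real \<Rightarrow> 'a \<Rightarrow> real" where
  "workload J V0 t \<omega> = net_input J t \<omega> + max (V0 \<omega>) (regulator J t \<omega>)"

definition sampling_epoch :: "(nat \<Rightarrow> 'a \<Rightarrow> real) \<Rightarrow> nat \<Rightarrow> 'a \<Rightarrow> real" where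
  "sampling_epoch T k \<omega> = (\<Sum>i=1..k. T i \<omega>)"

definition sampled :: "(real \<Rightarrow> 'a \<Rightarrow> real) \<Rightarrow> ('a \<Rightarrow> real) \<Rightarrow> (nat \<Rightarrow> 'a \<Rightarrow> real) \<Rightarrow>
    nat \<Rightarrow> 'a \<Rightarrow> real" where
  "sampled J V0 T k \<omega> = workload J V0 (sampling_epoch T k \<omega>) \<omega>"

definition laplace_exponent :: "'a measure \<Rightarrow> (real \<Rightarrow> 'a \<Rightarrow> real) \<Rightarrow> real \<Rightarrow> real" where
  "laplace_exponent M J \<alpha> = ln (\<integral>\<omega>. exp (- \<alpha> * net_input J 1 \<omega>) \<partial>M)"

definition inverse_exponent :: "'a measure \<Rightarrow> (real \<Rightarrow> 'a \<Rightarrow> real) \<Rightarrow> real \<Rightarrow> real" where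
  "inverse_exponent M J \<xi> = (THE \<beta>. 0 < \<beta> \<and> laplace_exponent M J \<beta> = \<xi>)"

definition empty_prob :: "'a measure \<Rightarrow> (real \<Rightarrow> 'a \<Rightarrow> real) \<Rightarrow> ('a \<Rightarrow> real) \<Rightarrow>
    (real \<Rightarrow> nat \<Rightarrow> 'a \<Rightarrow> real) \<Rightarrow> nat \<Rightarrow> real \<Rightarrow> real" where
  "empty_prob M J V0 T k \<xi> = \<P>(\<omega> in M. sampled J V0 (T \<xi>) k \<omega> = 0 \<bar> V0 \<omega> = 0)"

definition rho :: "'a measure \<Rightarrow> (real \<Rightarrow> 'a \<Rightarrow> real) \<Rightarrow> nat \<Rightarrow> real \<Rightarrow> real" where
  "rho M J l = (deriv ^^ l) (\<lambda>\<xi>. 1 / inverse_exponent M J \<xi>)"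

text \<open>
  \<open>deriv\<close> is total and says nothing at points where the derivative does not exist, so the
  existence of the iterated derivatives has to be stated separately.
\<close>

definition smooth_at :: "(real \<Rightarrow> real) \<Rightarrow> real \<Rightarrow> bool" where
  "smooth_at f x \<longleftrightarrow> (\<forall>l. (deriv ^^ l) f differentiable at x)"

end

theory Submission
  imports Defs
begin

text \<open>
  Let \<open>W\<close> be the workload started empty and \<open>q t = P (W t = 0)\<close>. For \<open>\<beta> > 0\<close> with \<open>\<phi> \<beta> = \<xi> > 0\<close>,
  independence of increments and the absence of a drift show that
  \<open>exp (- \<xi> t) * E (exp (- \<beta> W t))\<close> has right derivative \<open>- \<beta> exp (- \<xi> t) q t\<close>; integrating its difference
  quotients over the half-line gives \<open>\<beta> * F \<xi> = 1\<close> for the Laplace transform \<open>F\<close> of \<open>q\<close>. Thus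
  \<open>\<beta>\<close> is unique and \<open>1 / \<psi> = F\<close>, which makes \<open>\<psi>\<close> smooth. As \<open>S\<^sub>k\<close> has an Erlang distribution,
  \<open>p\<^sub>k\<close> is a multiple of the \<open>(k - 1)\<close>-st derivative of \<open>F\<close>; the sum formula telescopes, and the
  recursion is the Leibniz rule for \<open>F * \<psi> = 1\<close>.
\<close>

subsection \<open>Iterated real derivatives\<close>

text \<open>The rate of the transform is only computed along the steps \<open>h = 1 / n\<close>:
  there independent increments give the transform of \<open>J h\<close> as an n-th root of the one
  at time 1, without any continuity in time. For the same reason no fundamental theorem of calculus
  is applied.

  Without reflection, a step would lead from W to \<open>W + j - h\<close>, with j the increment of
  J; by independence and \<phi> \<beta> = \<xi> this multiplies the transform by exp (\<xi> h).
  Reflection matters only if W < h. The event 0 < W < h has vanishing probability, and on W = 0 the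
  correction is about \<beta> h unless j is comparable to h. Here the missing drift enters: J(h) / h
  tends to 0 in probability, because the jump part of the exponent grows sublinearly.

  The infimum over an uncountable time set is the other obstacle. By right continuity it is a limit
  of minima over finite grids, hence of functions of finitely many increments. This gives the
  independence from later increments and also measurability with respect to the sigma-algebra of the
  path alone, which the independence assumptions ask for.\<close>

definition times_diff_on :: "nat \<Rightarrow> (real \<Rightarrow> real) \<Rightarrow> real set \<Rightarrow> bool" where
  "times_diff_on n f S \<longleftrightarrow> (\<forall>l<n. \<forall>x\<in>S. (deriv ^^ l) f differentiable at x)"

lemma times_diff_on_0 [simp]: "times_diff_on 0 f S"
  by (simp add: times_diff_on_def)

text \<open>Splitting off the innermost derivative, not the outermost one, reduces order
  \<open>Suc n\<close> of \<open>f\<close> to order \<open>n\<close> of \<open>deriv f\<close>; the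
  closure properties below are inductions over this step.\<close>

lemma times_diff_on_Suc:
  "times_diff_on (Suc n) f S \<longleftrightarrow> (\<forall>x\<in>S. f differentiable at x) \<and> times_diff_on n (deriv f) S"
  unfolding times_diff_on_def
  by (subst All_less_Suc2) (simp add: funpow_Suc_right del: funpow.simps)

lemma times_diff_on_Suc_imp: "times_diff_on (Suc n) f S \<Longrightarrow> times_diff_on n f S"
  by (simp add: times_diff_on_def)

text \<open>Openness matters: \<open>deriv\<close> at a point depends on the values nearby, so
  agreement has to be carried along on a whole neighbourhood.\<close>

lemma deriv_funpow_cong:
  fixes f g :: "real \<Rightarrow> real"
  assumes "open S" "\<And>x. x \<in> S \<Longrightarrow> f x = g x" "x \<in> S"
  shows "(deriv ^^ l) f x = (deriv ^^ l) g x"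
  using \<open>x \<in> S\<close>
proof (induction l arbitrary: x)
  case (Suc l)
  have "\<forall>\<^sub>F y in nhds x. (deriv ^^ l) f y = (deriv ^^ l) g y"
    using eventually_nhds_in_open[OF assms(1) Suc.prems] by eventually_elim (rule Suc.IH)
  then show ?case
    by (simp add: deriv_cong_ev)
qed (simp add: assms)

lemma differentiable_at_cong_open:
  fixes f g :: "real \<Rightarrow> real"
  assumes "open S" "\<And>x. x \<in> S \<Longrightarrow> f x = g x" "x \<in> S" "f differentiable at x"
  shows "g differentiable at x"
  using assms by (auto simp: differentiable_def intro: has_derivative_transform_within_open)

lemma times_diff_on_cong:
  assumes "open S" "\<And>x. x \<in> S \<Longrightarrow> f x = g x" "times_diff_on n f S"
  shows "times_diff_on n g S"
  unfolding times_diff_on_def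
proof (intro allI impI ballI)
  fix l x assume "l < n" "x \<in> S"
  show "(deriv ^^ l) g differentiable at x"
    by (rule differentiable_at_cong_open[OF \<open>open S\<close> deriv_funpow_cong[OF assms(1,2)]])
      (use assms(3) \<open>l < n\<close> \<open>x \<in> S\<close> in \<open>auto simp: times_diff_on_def\<close>)
qed

lemma DERIV_higher_deriv:
  assumes "times_diff_on n f S" "l < n" "x \<in> S"
  shows "((deriv ^^ l) f has_real_derivative (deriv ^^ Suc l) f x) (at x)"
  using assms by (auto simp: times_diff_on_def DERIV_deriv_iff_real_differentiable)

text \<open>A guessed sequence \<open>D\<close> of successive derivatives settles existence and
  values of all \<open>deriv ^^ l\<close> at once. It serves for constants, for the identity and for
  \<open>laplace_moment\<close>.\<close>

lemma times_diff_onI: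
  assumes "open S"
    and "\<And>x. x \<in> S \<Longrightarrow> f x = D 0 x"
    and "\<And>l x. x \<in> S \<Longrightarrow> (D l has_real_derivative D (Suc l) x) (at x)"
  shows "times_diff_on n f S" and "x \<in> S \<Longrightarrow> (deriv ^^ l) f x = D l x"
proof -
  have *: "(deriv ^^ l) f x = D l x" if "x \<in> S" for l x
    using that
  proof (induction l arbitrary: x)
    case (Suc l)
    have "((deriv ^^ l) f has_real_derivative D (Suc l) x) (at x)"
      by (rule has_field_derivative_transform_within_open[OF assms(3)[OF Suc.prems] assms(1) Suc.prems])
        (simp add: Suc.IH)
    then show ?case
      by (simp add: DERIV_imp_deriv)
  qed (simp add: assms)
  show "x \<in> S \<Longrightarrow> (deriv ^^ l) f x = D l x"
    by (rule *)
  show "times_diff_on n f S"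
    unfolding times_diff_on_def
  proof (intro allI impI ballI)
    fix l x assume "x \<in> S"
    show "(deriv ^^ l) f differentiable at x"
      by (rule differentiable_at_cong_open[OF assms(1) *[symmetric] \<open>x \<in> S\<close>])
        (use assms(3)[OF \<open>x \<in> S\<close>, of l] in \<open>auto simp: real_differentiable_def\<close>)
  qed
qed

lemma times_diff_on_add:
  assumes "open S" "times_diff_on n f S" "times_diff_on n g S"
  shows "times_diff_on n (\<lambda>x. f x + g x) S"
  using assms(2,3)
proof (induction n arbitrary: f g)
  case (Suc n)
  have "times_diff_on n (deriv (\<lambda>x. f x + g x)) S"
  proof (rule times_diff_on_cong[OF \<open>open S\<close>])
    show "times_diff_on n (\<lambda>x. deriv f x + deriv g x) S"
      using Suc by (simp add: times_diff_on_Suc)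
    show "deriv f x + deriv g x = deriv (\<lambda>x. f x + g x) x" if "x \<in> S" for x
      using Suc.prems that
      by (intro DERIV_imp_deriv[symmetric] DERIV_add)
        (auto simp: times_diff_on_Suc DERIV_deriv_iff_real_differentiable)
  qed
  with Suc.prems show ?case
    by (simp add: times_diff_on_Suc)
qed simp

text \<open>The derivative is a sum of products with one factor differentiated, hence the induction
  over all pairs \<open>f\<close>, \<open>g\<close>; the other factor is lowered by one order to
  fit.\<close>

lemma times_diff_on_mult:
  assumes "open S" "times_diff_on n f S" "times_diff_on n g S"
  shows "times_diff_on n (\<lambda>x. f x * g x) S"
  using assms(2,3)
proof (induction n arbitrary: f g)
  case (Suc n)
  have "times_diff_on n (deriv (\<lambda>x. f x * g x)) S"
  proof (rule times_diff_on_cong[OF \<open>open S\<close>])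
    show "times_diff_on n (\<lambda>x. deriv f x * g x + deriv g x * f x) S"
      using Suc.prems times_diff_on_Suc_imp
      by (intro times_diff_on_add Suc.IH \<open>open S\<close>) (auto simp: times_diff_on_Suc)
    show "deriv f x * g x + deriv g x * f x = deriv (\<lambda>x. f x * g x) x" if "x \<in> S" for x
      using Suc.prems that
      by (intro DERIV_imp_deriv[symmetric] DERIV_mult)
        (auto simp: times_diff_on_Suc DERIV_deriv_iff_real_differentiable)
  qed
  with Suc.prems show ?case
    by (simp add: times_diff_on_Suc)
qed simp

text \<open>The derivative is a product of \<open>deriv f\<close> and two copies of the inverse, so
  order \<open>n\<close> of the inverse, known by induction, suffices for order
  \<open>Suc n\<close>. The sign is written as a constant factor so that closure under products
  covers it.\<close>

lemma times_diff_on_inverse: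
  assumes "open S" "times_diff_on n f S" "\<And>x. x \<in> S \<Longrightarrow> f x \<noteq> 0"
  shows "times_diff_on n (\<lambda>x. inverse (f x)) S"
  using assms(2)
proof (induction n)
  case (Suc n)
  have IH: "times_diff_on n (\<lambda>x. inverse (f x)) S"
    using Suc times_diff_on_Suc_imp by blast
  have "times_diff_on n (deriv (\<lambda>x. inverse (f x))) S"
  proof (rule times_diff_on_cong[OF \<open>open S\<close>])
    have "times_diff_on n (\<lambda>x. -1) S"
      by (rule times_diff_onI(1)[where D = "\<lambda>l x. if l = 0 then -1 else 0"]) (auto simp: assms(1))
    then show "times_diff_on n (\<lambda>x. - 1 * (inverse (f x) * deriv f x * inverse (f x))) S"
      using Suc.prems by (intro times_diff_on_mult \<open>open S\<close> IH) (auto simp: times_diff_on_Suc)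
    show "- 1 * (inverse (f x) * deriv f x * inverse (f x)) = deriv (\<lambda>x. inverse (f x)) x"
      if "x \<in> S" for x
      using Suc.prems that assms(3)
      by (auto intro!: DERIV_imp_deriv[symmetric] DERIV_inverse'
          simp: times_diff_on_Suc DERIV_deriv_iff_real_differentiable)
  qed
  with Suc.prems assms(3) show ?case
    by (auto simp: times_diff_on_Suc)
qed simp

lemma higher_deriv_mult_real:
  fixes f g :: "real \<Rightarrow> real"
  assumes S: "open S" and f: "\<And>n. times_diff_on n f S" and g: "\<And>n. times_diff_on n g S"
    and x: "x \<in> S"
  shows "(deriv ^^ n) (\<lambda>x. f x * g x) x =
    (\<Sum>i\<le>n. real (n choose i) * (deriv ^^ i) f x * (deriv ^^ (n - i)) g x)"
  using x
proof (induction n arbitrary: x)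
  case (Suc n x)
  let ?F = "\<lambda>i. (deriv ^^ i) f x" and ?G = "\<lambda>i. (deriv ^^ i) g x"
  have F: "((deriv ^^ l) f has_real_derivative ?F (Suc l)) (at x)"
    and G: "((deriv ^^ l) g has_real_derivative ?G (Suc l)) (at x)" for l
    by (rule DERIV_higher_deriv[OF f lessI \<open>x \<in> S\<close>] DERIV_higher_deriv[OF g lessI \<open>x \<in> S\<close>])+
  have "((\<lambda>x. \<Sum>i\<le>n. real (n choose i) * (deriv ^^ i) f x * (deriv ^^ (n - i)) g x) has_real_derivative
     (\<Sum>i\<le>n. real (n choose i) * ?F (Suc i) * ?G (n - i) + ?G (Suc (n - i)) * (real (n choose i) * ?F i))) (at x)"
    by (intro DERIV_sum DERIV_mult DERIV_cmult F G)
  then have "((deriv ^^ n) (\<lambda>x. f x * g x) has_real_derivative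
     (\<Sum>i\<le>n. real (n choose i) * ?F (Suc i) * ?G (n - i) + ?G (Suc (n - i)) * (real (n choose i) * ?F i))) (at x)"
    by (rule has_field_derivative_transform_within_open[OF _ S \<open>x \<in> S\<close>]) (simp add: Suc.IH)
  then have "(deriv ^^ Suc n) (\<lambda>x. f x * g x) x =
     (\<Sum>i\<le>n. real (n choose i) * ?F (Suc i) * ?G (n - i)) + (\<Sum>i\<le>n. real (n choose i) * ?F i * ?G (Suc (n - i)))"
    by (simp add: DERIV_imp_deriv sum.distrib mult_ac)
  \<comment> \<open>The new summand \<open>i = Suc n\<close> vanishes because
    \<open>n choose Suc n = 0\<close>. After the index shift, Pascal's rule joins the two
    sums.\<close>
  also have "(\<Sum>i\<le>n. real (n choose i) * ?F i * ?G (Suc (n - i))) =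
     (\<Sum>i\<le>Suc n. real (n choose i) * ?F i * ?G (Suc n - i))"
    by (simp add: Suc_diff_le del: funpow.simps)
  also have "\<dots> = ?F 0 * ?G (Suc n) + (\<Sum>i\<le>n. real (n choose Suc i) * ?F (Suc i) * ?G (n - i))"
    by (subst sum.atMost_Suc_shift) (simp del: funpow.simps add: funpow_0)
  finally show ?case
    by (subst sum.atMost_Suc_shift)
      (simp del: funpow.simps add: funpow_0 sum.distrib[symmetric] algebra_simps)
qed simp

lemma higher_deriv_id_mult:
  fixes f :: "real \<Rightarrow> real"
  assumes S: "open S" and f: "\<And>n. times_diff_on n f S" and x: "x \<in> S"
  shows "(deriv ^^ n) (\<lambda>x. x * f x) x = x * (deriv ^^ n) f x + real n * (deriv ^^ (n - 1)) f x"
  using x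
proof (induction n arbitrary: x)
  case (Suc n x)
  have F: "((deriv ^^ l) f has_real_derivative (deriv ^^ Suc l) f x) (at x)" for l
    by (rule DERIV_higher_deriv[OF f lessI \<open>x \<in> S\<close>])
  \<comment> \<open>At \<open>n = 0\<close> the truncated \<open>n - 1\<close> is \<open>0\<close>
    and the orders of the two derivatives differ, but the factor \<open>real n\<close> removes both
    sides.\<close>
  have *: "real n * (deriv ^^ Suc (n - 1)) f x = real n * (deriv ^^ n) f x"
    by (cases n) auto
  have "((\<lambda>x. x * (deriv ^^ n) f x + real n * (deriv ^^ (n - 1)) f x) has_real_derivative
     1 * (deriv ^^ n) f x + (deriv ^^ Suc n) f x * x + real n * (deriv ^^ Suc (n - 1)) f x) (at x)"
    by (intro DERIV_add DERIV_mult DERIV_cmult F DERIV_ident)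
  then have "((deriv ^^ n) (\<lambda>x. x * f x) has_real_derivative
     1 * (deriv ^^ n) f x + (deriv ^^ Suc n) f x * x + real n * (deriv ^^ n) f x) (at x)"
    unfolding * by (rule has_field_derivative_transform_within_open[OF _ S \<open>x \<in> S\<close>]) (simp add: Suc.IH)
  then show ?case
    by (simp add: DERIV_imp_deriv algebra_simps)
qed simp

subsection \<open>Differentiation of Laplace transforms\<close>

text \<open>For bounded measurable \<open>q\<close> and positive \<xi>, this is the l-th derivative
  of the Laplace transform of \<open>q\<close>. The sign is kept inside \<open>(- t) ^ l\<close> so
  that differentiation merely raises \<open>l\<close>.\<close>

definition laplace_moment :: "(real \<Rightarrow> real) \<Rightarrow> nat \<Rightarrow> real \<Rightarrow> real" where
  "laplace_moment q l \<xi> = (\<integral>t. indicator {0..} t * ((- t) ^ l * exp (- \<xi> * t) * q t) \<partial>lborel)"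

text \<open>The function is a multiple of an Erlang density, whose zeroth moment is finite.\<close>

lemma integrable_power_exp:
  assumes "0 < \<xi>"
  shows "integrable lborel (\<lambda>t. indicator {0..} t * (t ^ l * exp (- \<xi> * t)) :: real)"
proof -
  have "integrable lborel (erlang_density l \<xi>)"
    using nn_integral_erlang_ith_moment[OF assms, of l 0] assms
    by (intro integrableI_nonneg) auto
  then have "integrable lborel (\<lambda>t. fact l / \<xi> ^ Suc l * erlang_density l \<xi> t)"
    by (intro integrable_mult_right)
  also have "(\<lambda>t. fact l / \<xi> ^ Suc l * erlang_density l \<xi> t) =
      (\<lambda>t. indicator {0..} t * (t ^ l * exp (- \<xi> * t)))"
    using assms by (auto simp: erlang_density_def indicator_def fun_eq_iff)
  finally show ?thesis .
qed

text \<open>Controls difference quotients of exponentials, both in the next lemma and in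
  \<open>reflected_step_rate\<close>.\<close>

lemma abs_exp_minus_1_le: "\<bar>exp u - 1\<bar> \<le> \<bar>u\<bar> * exp \<bar>u :: real\<bar>"
proof (cases "0 \<le> u")
  case True
  have "1 - u \<le> exp (- u)"
    using exp_ge_add_one_self[of "- u"] by simp
  then have "(1 - u) * exp u \<le> exp (- u) * exp u"
    by (intro mult_right_mono) auto
  then show ?thesis
    using True by (simp add: algebra_simps flip: exp_add)
next
  case False
  have "- u * 1 \<le> - u * exp (- u)"
    using False by (intro mult_left_mono) auto
  with exp_ge_add_one_self[of u] have "1 - exp u \<le> - u * exp (- u)"
    by linarith
  moreover have "\<bar>exp u - 1\<bar> = 1 - exp u" "\<bar>u\<bar> = - u"
    using False by auto
  ultimately show ?thesis
    by simp
qed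

lemma DERIV_laplace_moment:
  fixes q :: "real \<Rightarrow> real"
  assumes [measurable]: "q \<in> borel_measurable borel" and q: "\<And>t. \<bar>q t\<bar> \<le> 1" and "0 < \<xi>"
  shows "(laplace_moment q l has_real_derivative laplace_moment q (Suc l) \<xi>) (at \<xi>)"
proof -
  let ?f = "\<lambda>l \<xi> t. indicator {0..} t * ((- t) ^ l * exp (- \<xi> * t) * q t) :: real"
  have f_int: "integrable lborel (?f l \<xi>)" if "0 < \<xi>" for l \<xi>
  proof (rule Bochner_Integration.integrable_bound[OF integrable_power_exp[OF that, of l]])
    show "AE t in lborel. norm (?f l \<xi> t) \<le> norm (indicator {0..} t * (t ^ l * exp (- \<xi> * t)))"
      using q by (auto simp: abs_mult power_abs split: split_indicator intro!: mult_left_le)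
  qed simp
  \<comment> \<open>Increments below \<open>\<xi> / 2\<close> in absolute value leave the decay
    \<open>exp (- (\<xi> / 2) * t)\<close>, which gives one dominating function for all difference
    quotients; its additional factor \<open>t\<close> comes from
    \<open>abs_exp_minus_1_le\<close>.\<close>
  have "((\<lambda>h. (laplace_moment q l (\<xi> + h) - laplace_moment q l \<xi>) / h) \<longlongrightarrow> laplace_moment q (Suc l) \<xi>)
      (at 0 within {- \<xi> / 2<..<\<xi> / 2})"
    unfolding tendsto_at_iff_sequentially comp_def
  proof (intro allI impI)
    fix X :: "nat \<Rightarrow> real"
    assume X: "\<forall>i. X i \<in> {- \<xi> / 2<..<\<xi> / 2} - {0}" "X \<longlonglongrightarrow> 0"
    have "(\<lambda>i. \<integral>t. (?f l (\<xi> + X i) t - ?f l \<xi> t) / X i \<partial>lborel) \<longlonglongrightarrow> (\<integral>t. ?f (Suc l) \<xi> t \<partial>lborel)"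
    proof (rule integral_dominated_convergence)
      show "integrable lborel (\<lambda>t. indicator {0..} t * (t ^ Suc l * exp (- (\<xi> / 2) * t)) :: real)"
        using \<open>0 < \<xi>\<close> by (intro integrable_power_exp) auto
      show "AE t in lborel. (\<lambda>i. (?f l (\<xi> + X i) t - ?f l \<xi> t) / X i) \<longlonglongrightarrow> ?f (Suc l) \<xi> t"
      proof (rule AE_I2)
        fix t :: real
        have "((\<lambda>x. ?f l x t) has_real_derivative ?f (Suc l) \<xi> t) (at \<xi>)"
          by (auto intro!: derivative_eq_intros)
        then have "((\<lambda>h. (?f l (\<xi> + h) t - ?f l \<xi> t) / h) \<longlongrightarrow> ?f (Suc l) \<xi> t) (at 0)"
          unfolding DERIV_def .
        moreover have "filterlim X (at 0) sequentially"
          using X by (auto simp: filterlim_at)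
        ultimately show "(\<lambda>i. (?f l (\<xi> + X i) t - ?f l \<xi> t) / X i) \<longlonglongrightarrow> ?f (Suc l) \<xi> t"
          by (rule filterlim_compose)
      qed
      fix i
      show "AE t in lborel. norm ((?f l (\<xi> + X i) t - ?f l \<xi> t) / X i) \<le>
          indicator {0..} t * (t ^ Suc l * exp (- (\<xi> / 2) * t))"
      proof (rule AE_I2)
        fix t :: real
        show "norm ((?f l (\<xi> + X i) t - ?f l \<xi> t) / X i) \<le>
          indicator {0..} t * (t ^ Suc l * exp (- (\<xi> / 2) * t))"
        proof (cases "0 \<le> t")
          case True
          have Xi: "X i \<noteq> 0" "\<bar>X i\<bar> \<le> \<xi> / 2"
            using X(1)[rule_format, of i] by auto
          have "?f l (\<xi> + X i) t - ?f l \<xi> t = (- t) ^ l * exp (- \<xi> * t) * (exp (- X i * t) - 1) * q t"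
            using True by (simp add: algebra_simps exp_add[symmetric])
          then have "\<bar>?f l (\<xi> + X i) t - ?f l \<xi> t\<bar> = t ^ l * exp (- \<xi> * t) * \<bar>exp (- X i * t) - 1\<bar> * \<bar>q t\<bar>"
            using True by (simp add: abs_mult power_abs)
          also have "\<dots> \<le> t ^ l * exp (- \<xi> * t) * (\<bar>X i\<bar> * t * exp (\<bar>X i\<bar> * t)) * 1"
            using abs_exp_minus_1_le[of "- X i * t"] True q
            by (intro mult_mono mult_left_mono) (auto simp: abs_mult)
          also have "\<dots> = \<bar>X i\<bar> * (t ^ Suc l * exp (- (\<xi> - \<bar>X i\<bar>) * t))"
            by (simp add: algebra_simps exp_add[symmetric])
          also have "\<dots> \<le> \<bar>X i\<bar> * (t ^ Suc l * exp (- (\<xi> / 2) * t))"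
          proof -
            have "- (\<xi> - \<bar>X i\<bar>) * t \<le> - (\<xi> / 2) * t"
              using Xi(2) True by (intro mult_right_mono) auto
            then show ?thesis
              using True by (intro mult_left_mono) auto
          qed
          finally show ?thesis
            using True Xi(1) by (simp add: abs_divide divide_le_eq mult_ac)
        qed simp
      qed
    qed simp_all
    moreover have "(\<integral>t. (?f l (\<xi> + X i) t - ?f l \<xi> t) / X i \<partial>lborel) =
        (laplace_moment q l (\<xi> + X i) - laplace_moment q l \<xi>) / X i" for i
    proof -
      have "0 < \<xi> + X i"
        using X(1)[rule_format, of i] \<open>0 < \<xi>\<close> by auto
      then show ?thesis
        unfolding laplace_moment_def integral_divide_zero
        by (subst Bochner_Integration.integral_diff[OF f_int f_int]) (auto simp: \<open>0 < \<xi>\<close>)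
    qed
    ultimately show "(\<lambda>i. (laplace_moment q l (\<xi> + X i) - laplace_moment q l \<xi>) / X i) \<longlonglongrightarrow>
        laplace_moment q (Suc l) \<xi>"
      unfolding laplace_moment_def[of q "Suc l"] by (simp only:)
  qed
  then have "((\<lambda>h. (laplace_moment q l (\<xi> + h) - laplace_moment q l \<xi>) / h) \<longlongrightarrow> laplace_moment q (Suc l) \<xi>) (at 0)"
    by (subst (asm) at_within_open) (use \<open>0 < \<xi>\<close> in auto)
  then show ?thesis
    by (simp add: DERIV_def)
qed

subsection \<open>The workload started empty\<close>

definition reflected :: "(real \<Rightarrow> 'a \<Rightarrow> real) \<Rightarrow> real \<Rightarrow> 'a \<Rightarrow> real" where
  "reflected J t \<omega> = net_input J t \<omega> + regulator J t \<omega>"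

definition grid_reflected :: "(real \<Rightarrow> 'a \<Rightarrow> real) \<Rightarrow> nat \<Rightarrow> real \<Rightarrow> 'a \<Rightarrow> real" where
  "grid_reflected J n t \<omega> =
    net_input J t \<omega> - Min ((\<lambda>i. net_input J (t * real i / real n) \<omega>) ` {..n})"

text \<open>The grid ends in \<open>t\<close> itself. For this the grid size must be positive: with
  size \<open>0\<close>, division by zero leaves \<open>0\<close> as the only grid point.\<close>

lemma grid_reflected_nonneg: "0 \<le> grid_reflected J (Suc n) t \<omega>"
proof -
  have "net_input J t \<omega> \<in> (\<lambda>i. net_input J (t * real i / real (Suc n)) \<omega>) ` {..Suc n}"
    by (rule image_eqI[of _ _ "Suc n"]) (simp_all del: of_nat_Suc)
  then show ?thesis
    unfolding grid_reflected_def by simp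
qed

text \<open>The jump part of the exponent: for \<open>0 \<le> \<alpha>\<close>, the transform of
  \<open>J 1\<close> is \<open>exp (- laplace_levy \<nu> \<alpha>)\<close>, and \<phi> is the
  identity minus this function.\<close>

definition laplace_levy :: "real measure \<Rightarrow> real \<Rightarrow> real" where
  "laplace_levy \<nu> \<alpha> = (\<integral>x. 1 - exp (- \<alpha> * x) \<partial>\<nu>)"

context levy_process
begin

lemma right_continuous_sequentially:
  assumes "\<omega> \<in> space M" "\<And>n. t \<le> u n" "u \<longlonglongrightarrow> t" "0 \<le> t"
  shows "(\<lambda>n. J (u n) \<omega>) \<longlonglongrightarrow> J t \<omega>"
proof -
  have "continuous (at t within {t..}) (\<lambda>s. J s \<omega>)"
    using right_continuous[OF assms(1,4)] by (simp add: at_within_Ici_at_right)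
  then show ?thesis
    by (rule continuous_within_tendsto_compose) (use assms in auto)
qed

lemma expectation_increment:
  fixes f :: "real \<Rightarrow> real"
  assumes [measurable]: "f \<in> borel_measurable borel" and "0 \<le> s" "0 \<le> t"
  shows "expectation (\<lambda>\<omega>. f (J (s + t) \<omega> - J s \<omega>)) = expectation (\<lambda>\<omega>. f (J t \<omega>))"
proof -
  have [measurable]: "J (s + t) \<in> borel_measurable M" "J s \<in> borel_measurable M" "J t \<in> borel_measurable M"
    using assms by (auto intro: random_variable_at)
  have "expectation (\<lambda>\<omega>. f (J (s + t) \<omega> - J s \<omega>)) = (\<integral>x. f x \<partial>distr M borel (\<lambda>\<omega>. J (s + t) \<omega> - J s \<omega>))"
    by (subst integral_distr) auto
  also have "\<dots> = expectation (\<lambda>\<omega>. f (J t \<omega>))"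
    using assms by (simp add: stationary_increments integral_distr)
  finally show ?thesis .
qed

end

section \<open>Pathwise bounds for the reflected process\<close>

context pure_jump_subordinator
begin

lemma J_mono: "\<omega> \<in> space M \<Longrightarrow> 0 \<le> s \<Longrightarrow> s \<le> t \<Longrightarrow> J s \<omega> \<le> J t \<omega>"
  using nondecreasing[of \<omega>] by (auto simp: mono_on_def)

lemma J_nonneg: "\<omega> \<in> space M \<Longrightarrow> 0 \<le> t \<Longrightarrow> 0 \<le> J t \<omega>"
  using J_mono[of \<omega> 0 t] start by simp

lemma bdd_below_net_input: "\<omega> \<in> space M \<Longrightarrow> bdd_below ((\<lambda>s. net_input J s \<omega>) ` {0..t})"
proof (rule bdd_belowI2)
  show "- t \<le> net_input J s \<omega>" if "\<omega> \<in> space M" "s \<in> {0..t}" for s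
    using J_nonneg[of \<omega> s] that by (auto simp: net_input_def)
qed

lemma regulator_ge: "\<omega> \<in> space M \<Longrightarrow> 0 \<le> s \<Longrightarrow> s \<le> t \<Longrightarrow> - net_input J s \<omega> \<le> regulator J t \<omega>"
  unfolding regulator_def by (simp add: cINF_lower[OF bdd_below_net_input])

lemma regulator_le:
  "0 \<le> t \<Longrightarrow> (\<And>s. 0 \<le> s \<Longrightarrow> s \<le> t \<Longrightarrow> - net_input J s \<omega> \<le> c) \<Longrightarrow> regulator J t \<omega> \<le> c"
  unfolding regulator_def using cINF_greatest[of "{0..t}" "- c" "\<lambda>s. net_input J s \<omega>"]
  by (fastforce simp: minus_le_iff)

lemma regulator_nonneg: "\<omega> \<in> space M \<Longrightarrow> 0 \<le> t \<Longrightarrow> 0 \<le> regulator J t \<omega>"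
  using regulator_ge[of \<omega> 0 t] by (simp add: net_input_def start)

lemma reflected_nonneg: "\<omega> \<in> space M \<Longrightarrow> 0 \<le> t \<Longrightarrow> 0 \<le> reflected J t \<omega>"
  using regulator_ge[of \<omega> t t] by (simp add: reflected_def)

lemma reflected_0: "\<omega> \<in> space M \<Longrightarrow> reflected J 0 \<omega> = 0"
  by (simp add: reflected_def regulator_def)

text \<open>Enlarging the interval can only lower the infimum, so the regulator does not
  decrease.\<close>

lemma reflected_step_ge:
  assumes "\<omega> \<in> space M" "0 \<le> t" "0 \<le> h"
  shows "reflected J t \<omega> + (J (t + h) \<omega> - J t \<omega>) - h \<le> reflected J (t + h) \<omega>"
proof -
  have "regulator J t \<omega> \<le> regulator J (t + h) \<omega>"
    using assms by (intro regulator_le regulator_ge) auto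
  then show ?thesis
    by (simp add: reflected_def net_input_def)
qed

text \<open>As \<open>J\<close> is non-decreasing, the net input falls by at most \<open>h\<close>
  after \<open>t\<close>. Since \<open>reflected J t\<close> is its height above the running
  infimum, the infimum can drop by at most the excess of \<open>h\<close> over this height.\<close>

lemma reflected_step_le:
  assumes "\<omega> \<in> space M" "0 \<le> t" "0 \<le> h"
  shows "reflected J (t + h) \<omega> \<le>
    reflected J t \<omega> + (J (t + h) \<omega> - J t \<omega>) - h + max 0 (h - reflected J t \<omega>)"
proof -
  have "regulator J (t + h) \<omega> \<le> regulator J t \<omega> + max 0 (h - reflected J t \<omega>)"
  proof (rule regulator_le)
    fix s assume s: "0 \<le> s" "s \<le> t + h"
    show "- net_input J s \<omega> \<le> regulator J t \<omega> + max 0 (h - reflected J t \<omega>)"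
    proof (cases "s \<le> t")
      case True
      then show ?thesis
        using regulator_ge[OF assms(1) s(1) True] by simp
    next
      case False
      then show ?thesis
        using J_mono[OF assms(1,2), of s] s by (simp add: reflected_def net_input_def)
    qed
  qed (use assms in auto)
  then show ?thesis
    by (simp add: reflected_def net_input_def)
qed

text \<open>The two one-step bounds enclose the process. The reflection term is at most
  \<open>h\<close>, because the process is nonnegative, and so is cancelled by \<open>- h\<close> in
  the upper bound.\<close>

lemma reflected_right_continuous:
  assumes "\<omega> \<in> space M" "\<And>n. t \<le> u n" "u \<longlonglongrightarrow> t" "0 \<le> t"
  shows "(\<lambda>n. reflected J (u n) \<omega>) \<longlonglongrightarrow> reflected J t \<omega>"
proof (rule tendsto_sandwich)
  note J = right_continuous_sequentially[OF assms]
  have "(\<lambda>n. reflected J t \<omega> + (J (u n) \<omega> - J t \<omega>) - (u n - t)) \<longlonglongrightarrow>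
      reflected J t \<omega> + (J t \<omega> - J t \<omega>) - (t - t)"
    by (intro tendsto_intros J assms)
  then show "(\<lambda>n. reflected J t \<omega> + (J (u n) \<omega> - J t \<omega>) - (u n - t)) \<longlonglongrightarrow> reflected J t \<omega>"
    by simp
  have "(\<lambda>n. reflected J t \<omega> + (J (u n) \<omega> - J t \<omega>)) \<longlonglongrightarrow> reflected J t \<omega> + (J t \<omega> - J t \<omega>)"
    by (intro tendsto_intros J)
  then show "(\<lambda>n. reflected J t \<omega> + (J (u n) \<omega> - J t \<omega>)) \<longlonglongrightarrow> reflected J t \<omega>"
    by simp
  show "\<forall>\<^sub>F n in sequentially.
      reflected J t \<omega> + (J (u n) \<omega> - J t \<omega>) - (u n - t) \<le> reflected J (u n) \<omega>"
    using reflected_step_ge[OF assms(1,4), of "u _ - t"] assms(2) by simp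
  have "reflected J (u n) \<omega> \<le> reflected J t \<omega> + (J (u n) \<omega> - J t \<omega>)" for n
    using reflected_step_le[OF assms(1,4), of "u n - t"] assms(2)[of n]
      reflected_nonneg[OF assms(1,4)] by simp
  then show "\<forall>\<^sub>F n in sequentially.
      reflected J (u n) \<omega> \<le> reflected J t \<omega> + (J (u n) \<omega> - J t \<omega>)"
    by simp
qed

section \<open>Grid approximation and measurability\<close>

lemma grid_reflected_tendsto:
  assumes "\<omega> \<in> space M" "0 \<le> t"
  shows "(\<lambda>n. grid_reflected J n t \<omega>) \<longlonglongrightarrow> reflected J t \<omega>"
proof -
  define X where "X = (\<lambda>s. net_input J s \<omega>)"
  define m where "m n = Min ((\<lambda>i. X (t * real i / real n)) ` {..n})" for n
  have grid: "0 \<le> t * real i / real n" "t * real i / real n \<le> t" if "i \<le> n" for i n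
    using that assms(2) by (auto simp: divide_le_eq mult_left_mono)
  have "m \<longlonglongrightarrow> (INF s\<in>{0..t}. X s)"
  proof (rule order_tendstoI)
    fix a assume a: "a < (INF s\<in>{0..t}. X s)"
    have "a < m n" for n
      unfolding m_def
    proof (subst Min_gr_iff, goal_cases)
      case 3
      have "(INF s\<in>{0..t}. X s) \<le> X (t * real i / real n)" if "i \<le> n" for i
        unfolding X_def by (intro cINF_lower bdd_below_net_input assms) (use grid that in auto)
      with a show ?case
        by (auto intro: less_le_trans)
    qed auto
    then show "\<forall>\<^sub>F n in sequentially. a < m n"
      by simp
  next
    fix a assume "(INF s\<in>{0..t}. X s) < a"
    then obtain s where s: "0 \<le> s" "s \<le> t" "X s < a"
      using assms by (subst (asm) cINF_less_iff) (auto simp: X_def bdd_below_net_input)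
    \<comment> \<open>The index of the first grid point at or after \<open>s\<close>: the points
      \<open>u n\<close> stay below or at \<open>t\<close> and approach \<open>s\<close> from the
      right, the side on which the path is continuous. For \<open>t = 0\<close>, division by zero
      gives index \<open>0\<close>, which is correct.\<close>
    define i where "i n = nat \<lceil>s * real n / t\<rceil>" for n
    define u where "u n = t * real (i n) / real n" for n
    have i: "i n \<le> n" for n
    proof -
      have "s * real n / t \<le> real n"
        using s by (cases "t = 0") (auto simp: divide_le_eq intro!: order_trans[OF mult_right_mono[of s t "real n"]])
      then show ?thesis
        by (simp add: i_def ceiling_le_iff)
    qed
    have i': "real (i n) = of_int \<lceil>s * real n / t\<rceil>" for n
      using s by (auto simp: i_def)
    have u_ge: "s \<le> u n" and u_le: "u n \<le> s + t / real n" if "n > 0" for n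
    proof -
      have "s * real n / t \<le> real (i n)" "real (i n) \<le> s * real n / t + 1"
        unfolding i' by linarith+
      then have "t * (s * real n / t) / real n \<le> u n" "u n \<le> t * (s * real n / t + 1) / real n"
        unfolding u_def using assms(2) by (intro divide_right_mono mult_left_mono; simp)+
      moreover have "t * (s * real n / t) / real n = s"
        using s that by (cases "t = 0") auto
      ultimately show "s \<le> u n" "u n \<le> s + t / real n"
        unfolding distrib_left add_divide_distrib by simp_all
    qed
    \<comment> \<open>The bounds on \<open>u n\<close> need \<open>n > 0\<close>, hence the shift,
      which \<open>eventually_sequentially_Suc\<close> undoes at the end.\<close>
    have "(\<lambda>n. u (Suc n)) \<longlonglongrightarrow> s"
    proof (rule tendsto_sandwich[of "\<lambda>_. s" _ _ "\<lambda>n. s + t / real (Suc n)"])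
      have "(\<lambda>n. s + t * inverse (real (Suc n))) \<longlonglongrightarrow> s + t * 0"
        by (intro tendsto_intros LIMSEQ_inverse_real_of_nat)
      then show "(\<lambda>n. s + t / real (Suc n)) \<longlonglongrightarrow> s"
        by (simp add: divide_inverse)
    qed (use u_ge u_le in \<open>simp_all del: of_nat_Suc\<close>)
    with s(1) u_ge assms(1) have "(\<lambda>n. X (u (Suc n))) \<longlonglongrightarrow> X s"
      unfolding X_def net_input_def by (intro tendsto_diff right_continuous_sequentially) auto
    then have "\<forall>\<^sub>F n in sequentially. X (u (Suc n)) < a"
      using s(3) by (rule order_tendstoD)
    moreover have "m (Suc n) \<le> X (u (Suc n))" for n
      unfolding m_def u_def using i by (intro Min_le) auto
    ultimately have "\<forall>\<^sub>F n in sequentially. m (Suc n) < a"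
      by (auto elim!: eventually_mono intro: le_less_trans)
    then show "\<forall>\<^sub>F n in sequentially. m n < a"
      by (simp add: eventually_sequentially_Suc[of "\<lambda>n. m n < a"])
  qed
  then have "(\<lambda>n. X t - m n) \<longlonglongrightarrow> X t - (INF s\<in>{0..t}. X s)"
    by (intro tendsto_intros)
  then show ?thesis
    by (simp add: grid_reflected_def reflected_def regulator_def X_def m_def)
qed

lemma measurable_grid_reflected:
  assumes "\<And>s. 0 \<le> s \<Longrightarrow> J s \<in> borel_measurable N" and "0 \<le> t"
  shows "grid_reflected J n t \<in> borel_measurable N"
  unfolding grid_reflected_def net_input_def using assms
  by (intro borel_measurable_diff borel_measurable_Min borel_measurable_const) auto

text \<open>The sigma-algebra \<open>N\<close> is left open, because independence from
  \<open>V0\<close> and from the sampling times calls for the sigma-algebra generated by the path,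
  or by the path and \<open>V0\<close>, in place of that of \<open>M\<close>.\<close>

lemma measurable_reflected:
  assumes N: "space N = space M" "\<And>s. 0 \<le> s \<Longrightarrow> J s \<in> borel_measurable N" and t: "0 \<le> t"
  shows "reflected J t \<in> borel_measurable N"
proof (rule borel_measurable_LIMSEQ_real)
  show "(\<lambda>n. grid_reflected J n t \<omega>) \<longlonglongrightarrow> reflected J t \<omega>" if "\<omega> \<in> space N" for \<omega>
    using that grid_reflected_tendsto N t by simp
  show "grid_reflected J n t \<in> borel_measurable N" for n
    using N t by (intro measurable_grid_reflected) auto
qed

text \<open>The clamping of the time at zero makes the process jointly measurable on the whole line.\<close>

lemma measurable_reflected_pair:
  assumes N: "space N = space M" "\<And>s. 0 \<le> s \<Longrightarrow> J s \<in> borel_measurable N"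
  shows "(\<lambda>(\<omega>, t). reflected J (max 0 t) \<omega>) \<in> borel_measurable (N \<Otimes>\<^sub>M borel)"
proof -
  \<comment> \<open>Rounds the time up to a multiple of \<open>1 / Suc n\<close>, strictly to the
    right. Only countably many values occur, so each approximation is jointly measurable, and right
    continuity gives the limit.\<close>
  define r where "r n t = real (nat \<lfloor>real (Suc n) * max 0 t\<rfloor> + 1) / real (Suc n)" for n t
  have r: "max 0 t \<le> r n t" "r n t \<le> max 0 t + inverse (real (Suc n))" for n t
  proof -
    have *: "real (nat \<lfloor>real (Suc n) * max 0 t\<rfloor>) = of_int \<lfloor>real (Suc n) * max 0 t\<rfloor>"
      by (simp add: zero_le_mult_iff)
    have "real (Suc n) * max 0 t \<le> real (nat \<lfloor>real (Suc n) * max 0 t\<rfloor> + 1)"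
      "real (nat \<lfloor>real (Suc n) * max 0 t\<rfloor> + 1) \<le> real (Suc n) * max 0 t + 1"
      unfolding of_nat_add * of_nat_1 by linarith+
    then have "real (Suc n) * max 0 t / real (Suc n) \<le> r n t"
      "r n t \<le> (real (Suc n) * max 0 t + 1) / real (Suc n)"
      unfolding r_def by (intro divide_right_mono; simp)+
    moreover have "real (Suc n) * x / real (Suc n) = x" for x
      by simp
    ultimately show "max 0 t \<le> r n t" "r n t \<le> max 0 t + inverse (real (Suc n))"
      unfolding add_divide_distrib inverse_eq_divide by (simp_all del: of_nat_Suc)
  qed
  have "(\<lambda>p. reflected J (max 0 (snd p)) (fst p)) \<in> borel_measurable (N \<Otimes>\<^sub>M borel)"
  proof (rule borel_measurable_LIMSEQ_real)
    fix n
    have [measurable]: "reflected J (real (k + 1) / real (Suc n)) \<in> borel_measurable N" for k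
      by (rule measurable_reflected[OF N]) auto
    have "(\<lambda>p. reflected J (real (k + 1) / real (Suc n)) (fst p)) \<in> borel_measurable (N \<Otimes>\<^sub>M borel)" for k
      by measurable
    moreover have "(\<lambda>p. nat \<lfloor>real (Suc n) * max 0 (snd p)\<rfloor>) \<in> (N \<Otimes>\<^sub>M borel) \<rightarrow>\<^sub>M count_space UNIV"
      by measurable
    ultimately show "(\<lambda>p. reflected J (r n (snd p)) (fst p)) \<in> borel_measurable (N \<Otimes>\<^sub>M borel)"
      unfolding r_def by (rule measurable_compose_countable)
  next
    fix p assume p: "p \<in> space (N \<Otimes>\<^sub>M (borel :: real measure))"
    show "(\<lambda>n. reflected J (r n (snd p)) (fst p)) \<longlonglongrightarrow> reflected J (max 0 (snd p)) (fst p)"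
    proof (rule reflected_right_continuous)
      show "(\<lambda>n. r n (snd p)) \<longlonglongrightarrow> max 0 (snd p)"
      proof (rule tendsto_sandwich[of "\<lambda>_. max 0 (snd p)" _ _ "\<lambda>n. max 0 (snd p) + inverse (real (Suc n))"])
        show "(\<lambda>n. max 0 (snd p) + inverse (real (Suc n))) \<longlonglongrightarrow> max 0 (snd p)"
          using tendsto_add[OF tendsto_const LIMSEQ_inverse_real_of_nat] by simp
      qed (use r in auto)
    qed (use p N r in \<open>auto simp: space_pair_measure\<close>)
  qed
  then show ?thesis
    by (simp add: split_beta')
qed

section \<open>Independence from the next increment\<close>

lemma expectation_grid_reflected_mult_increment:
  assumes "0 \<le> \<alpha>" "0 \<le> t" "0 \<le> h"
  shows "expectation (\<lambda>\<omega>. exp (- \<alpha> * grid_reflected J (Suc n) t \<omega>) * exp (- \<alpha> * (J (t + h) \<omega> - J t \<omega>))) =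
    expectation (\<lambda>\<omega>. exp (- \<alpha> * grid_reflected J (Suc n) t \<omega>)) *
    expectation (\<lambda>\<omega>. exp (- \<alpha> * (J (t + h) \<omega> - J t \<omega>)))"
proof -
  let ?N = "Suc n"
  \<comment> \<open>The grid of \<open>[0, t]\<close> has the indices up to \<open>?N\<close>, all
    later indices give \<open>t + h\<close>. Thus increment number \<open>?N\<close> is the one
    after \<open>t\<close>, and \<open>\<tau>\<close> is monotone on all natural numbers, as
    \<open>indep_increments\<close> requires.\<close>
  define \<tau> where "\<tau> i = (if i \<le> ?N then t * real i / real ?N else t + h)" for i
  define Y where "Y i \<omega> = J (\<tau> (Suc i)) \<omega> - J (\<tau> i) \<omega>" for i \<omega>
  have \<tau>_le: "t * real i / real ?N \<le> t" if "i \<le> ?N" for i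
  proof -
    have "t * real i \<le> t * real ?N"
      using that assms by (intro mult_left_mono) auto
    then show ?thesis
      by (simp add: divide_le_eq del: of_nat_Suc)
  qed
  have "mono \<tau>"
  proof (rule incseq_SucI)
    fix i
    have "t * real i / real ?N \<le> t * real (Suc i) / real ?N"
      using assms by (intro divide_right_mono mult_left_mono) auto
    then show "\<tau> i \<le> \<tau> (Suc i)"
      using \<tau>_le[of i] assms unfolding \<tau>_def by (auto simp del: of_nat_Suc)
  qed
  then have "indep_vars (\<lambda>_. borel) Y {..<Suc ?N}"
    unfolding Y_def by (intro indep_increments) (simp add: \<tau>_def)
  then have ind: "indep_var (Pi\<^sub>M {..<?N} (\<lambda>_. borel)) (\<lambda>\<omega>. restrict (\<lambda>i. Y i \<omega>) {..<?N})
      (Pi\<^sub>M {?N} (\<lambda>_. borel)) (\<lambda>\<omega>. restrict (\<lambda>i. Y i \<omega>) {?N})"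
    by (rule indep_var_restrict) auto
  \<comment> \<open>Partial sums of increments give back \<open>J\<close> on the grid, because
    \<open>\<tau> 0 = 0\<close> and \<open>J\<close> starts at \<open>0\<close>; so this is the grid
    version written as a function of the increments up to \<open>t\<close>.\<close>
  define \<Phi> where "\<Phi> y = exp (- \<alpha> * (((\<Sum>j<?N. y j) - t) -
      Min ((\<lambda>i. (\<Sum>j<i. y j) - t * real i / real ?N) ` {..?N})))" for y :: "nat \<Rightarrow> real"
  define \<Psi> where "\<Psi> y = exp (- \<alpha> * y ?N)" for y :: "nat \<Rightarrow> real"
  have [measurable]: "\<Phi> \<in> borel_measurable (Pi\<^sub>M {..<?N} (\<lambda>_. borel))"
    unfolding \<Phi>_def
    by (intro measurable_compose[OF _ borel_measurable_exp] borel_measurable_diff borel_measurable_times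
        borel_measurable_const borel_measurable_Min borel_measurable_sum measurable_component_singleton) auto
  have [measurable]: "\<Psi> \<in> borel_measurable (Pi\<^sub>M {?N} (\<lambda>_. borel))"
    unfolding \<Psi>_def by measurable
  have ind2: "indep_var borel (\<Phi> \<circ> (\<lambda>\<omega>. restrict (\<lambda>i. Y i \<omega>) {..<?N})) borel (\<Psi> \<circ> (\<lambda>\<omega>. restrict (\<lambda>i. Y i \<omega>) {?N}))"
    by (rule indep_var_compose[OF ind]) measurable
  have sumY: "(\<Sum>j<i. Y j \<omega>) = J (t * real i / real ?N) \<omega>" if "i \<le> ?N" "\<omega> \<in> space M" for i \<omega>
  proof -
    have "(\<Sum>j<i. Y j \<omega>) = J (\<tau> i) \<omega> - J (\<tau> 0) \<omega>"
      unfolding Y_def by (rule sum_lessThan_telescope)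
    then show ?thesis
      using that by (simp add: \<tau>_def start)
  qed
  have \<Phi>: "\<Phi> (restrict (\<lambda>i. Y i \<omega>) {..<?N}) = exp (- \<alpha> * grid_reflected J ?N t \<omega>)" if "\<omega> \<in> space M" for \<omega>
  proof -
    have eq: "(\<Sum>j<i. restrict (\<lambda>i. Y i \<omega>) {..<?N} j) = J (t * real i / real ?N) \<omega>" if "i \<le> ?N" for i
      using sumY[OF that \<open>\<omega> \<in> space M\<close>] that by simp
    have "(\<lambda>i. (\<Sum>j<i. restrict (\<lambda>i. Y i \<omega>) {..<?N} j) - t * real i / real ?N) ` {..?N} =
      (\<lambda>i. net_input J (t * real i / real ?N) \<omega>) ` {..?N}"
      by (intro image_cong refl) (simp only: atMost_iff eq net_input_def)
    moreover have "t * real ?N / real ?N = t"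
      by simp
    ultimately show ?thesis
      unfolding \<Phi>_def grid_reflected_def eq[OF order_refl] by (simp only: net_input_def)
  qed
  have \<Psi>: "\<Psi> (restrict (\<lambda>i. Y i \<omega>) {?N}) = exp (- \<alpha> * (J (t + h) \<omega> - J t \<omega>))" for \<omega>
  proof -
    have "t * real ?N / real ?N = t"
      by simp
    then show ?thesis
      by (simp add: \<Psi>_def Y_def \<tau>_def del: of_nat_Suc)
  qed
  have bounded: "integrable M (\<lambda>\<omega>. exp (- \<alpha> * X \<omega>))"
    if "\<And>\<omega>. \<omega> \<in> space M \<Longrightarrow> 0 \<le> X \<omega>" "(\<lambda>\<omega>. exp (- \<alpha> * X \<omega>)) \<in> borel_measurable M" for X :: "'a \<Rightarrow> real"
    using that assms by (intro integrable_const_bound[of _ 1]) auto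
  have [measurable]: "J t \<in> borel_measurable M" "J (t + h) \<in> borel_measurable M"
    using assms by (auto intro: random_variable_at)
  have [measurable]: "grid_reflected J ?N t \<in> borel_measurable M"
    using assms by (intro measurable_grid_reflected random_variable_at)
  have "expectation (\<lambda>\<omega>. (\<Phi> \<circ> (\<lambda>\<omega>. restrict (\<lambda>i. Y i \<omega>) {..<?N})) \<omega> * (\<Psi> \<circ> (\<lambda>\<omega>. restrict (\<lambda>i. Y i \<omega>) {?N})) \<omega>) =
    expectation (\<Phi> \<circ> (\<lambda>\<omega>. restrict (\<lambda>i. Y i \<omega>) {..<?N})) * expectation (\<Psi> \<circ> (\<lambda>\<omega>. restrict (\<lambda>i. Y i \<omega>) {?N}))"
  proof (rule indep_var_lebesgue_integral[OF ind2])
    show "integrable M (\<Phi> \<circ> (\<lambda>\<omega>. restrict (\<lambda>i. Y i \<omega>) {..<?N}))"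
      by (subst Bochner_Integration.integrable_cong[OF refl, of _ _ "\<lambda>\<omega>. exp (- \<alpha> * grid_reflected J ?N t \<omega>)"])
        (simp add: \<Phi>, intro bounded grid_reflected_nonneg, measurable)
    have "integrable M (\<lambda>\<omega>. exp (- \<alpha> * (J (t + h) \<omega> - J t \<omega>)))"
      using assms by (intro bounded) (auto simp: J_mono)
    then show "integrable M (\<Psi> \<circ> (\<lambda>\<omega>. restrict (\<lambda>i. Y i \<omega>) {?N}))"
      unfolding comp_def \<Psi> .
  qed
  then show ?thesis
    by (simp add: \<Phi> \<Psi> cong: Bochner_Integration.integral_cong)
qed

text \<open>Bounded convergence carries the grid identity to the limit, all factors lying between 0
  and 1; stationarity then replaces the increment by \<open>J h\<close>.\<close>

lemma expectation_reflected_mult_increment: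
  assumes "0 \<le> \<alpha>" "0 \<le> t" "0 \<le> h"
  shows "expectation (\<lambda>\<omega>. exp (- \<alpha> * reflected J t \<omega>) * exp (- \<alpha> * (J (t + h) \<omega> - J t \<omega>))) =
    expectation (\<lambda>\<omega>. exp (- \<alpha> * reflected J t \<omega>)) * expectation (\<lambda>\<omega>. exp (- \<alpha> * J h \<omega>))"
proof -
  have [measurable]: "reflected J t \<in> borel_measurable M"
    by (rule measurable_reflected) (auto simp: random_variable_at assms)
  have [measurable]: "J t \<in> borel_measurable M" "J (t + h) \<in> borel_measurable M"
    using assms by (auto intro: random_variable_at)
  have [measurable]: "grid_reflected J n t \<in> borel_measurable M" for n
    using assms by (intro measurable_grid_reflected random_variable_at)
  have lim: "(\<lambda>n. exp (- \<alpha> * grid_reflected J (Suc n) t \<omega>)) \<longlonglongrightarrow> exp (- \<alpha> * reflected J t \<omega>)" if "\<omega> \<in> space M" for \<omega>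
    using LIMSEQ_Suc[OF grid_reflected_tendsto[OF that assms(2)]] by (intro tendsto_intros)
  have "(\<lambda>n. expectation (\<lambda>\<omega>. exp (- \<alpha> * grid_reflected J (Suc n) t \<omega>) * exp (- \<alpha> * (J (t + h) \<omega> - J t \<omega>))))
    \<longlonglongrightarrow> expectation (\<lambda>\<omega>. exp (- \<alpha> * reflected J t \<omega>) * exp (- \<alpha> * (J (t + h) \<omega> - J t \<omega>)))"
  proof (rule integral_dominated_convergence[where w = "\<lambda>_. 1"])
    show "AE \<omega> in M. (\<lambda>n. exp (- \<alpha> * grid_reflected J (Suc n) t \<omega>) * exp (- \<alpha> * (J (t + h) \<omega> - J t \<omega>)))
      \<longlonglongrightarrow> exp (- \<alpha> * reflected J t \<omega>) * exp (- \<alpha> * (J (t + h) \<omega> - J t \<omega>))"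
      by (rule AE_I2) (intro tendsto_mult lim tendsto_const)
    show "AE \<omega> in M. norm (exp (- \<alpha> * grid_reflected J (Suc n) t \<omega>) * exp (- \<alpha> * (J (t + h) \<omega> - J t \<omega>))) \<le> 1" for n
      using assms by (intro AE_I2) (auto simp: J_mono abs_mult grid_reflected_nonneg intro!: mult_le_one)
  qed simp_all
  moreover have "(\<lambda>n. expectation (\<lambda>\<omega>. exp (- \<alpha> * grid_reflected J (Suc n) t \<omega>)) *
      expectation (\<lambda>\<omega>. exp (- \<alpha> * (J (t + h) \<omega> - J t \<omega>))))
    \<longlonglongrightarrow> expectation (\<lambda>\<omega>. exp (- \<alpha> * reflected J t \<omega>)) * expectation (\<lambda>\<omega>. exp (- \<alpha> * (J (t + h) \<omega> - J t \<omega>)))"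
  proof (intro tendsto_mult tendsto_const integral_dominated_convergence[where w = "\<lambda>_. 1"])
    show "AE \<omega> in M. (\<lambda>n. exp (- \<alpha> * grid_reflected J (Suc n) t \<omega>)) \<longlonglongrightarrow> exp (- \<alpha> * reflected J t \<omega>)"
      by (rule AE_I2) (rule lim)
    show "AE \<omega> in M. norm (exp (- \<alpha> * grid_reflected J (Suc n) t \<omega>)) \<le> 1" for n
      using assms by (intro AE_I2) (auto simp: grid_reflected_nonneg)
  qed simp_all
  ultimately have "expectation (\<lambda>\<omega>. exp (- \<alpha> * reflected J t \<omega>) * exp (- \<alpha> * (J (t + h) \<omega> - J t \<omega>))) =
    expectation (\<lambda>\<omega>. exp (- \<alpha> * reflected J t \<omega>)) * expectation (\<lambda>\<omega>. exp (- \<alpha> * (J (t + h) \<omega> - J t \<omega>)))"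
    unfolding expectation_grid_reflected_mult_increment[OF assms] by (rule LIMSEQ_unique)
  then show ?thesis
    using expectation_increment[of "\<lambda>x. exp (- \<alpha> * x)" t h] assms by simp
qed

section \<open>Short times and the absence of a drift\<close>

text \<open>\<open>J 1\<close> is a sum of \<open>n\<close> independent increments with the law of
  \<open>J (1 / n)\<close>, so its transform is an n-th power, and nonnegative n-th roots are
  unique.\<close>

lemma laplace_J_inverse_nat:
  assumes "0 \<le> \<alpha>" "0 < n"
  shows "expectation (\<lambda>\<omega>. exp (- \<alpha> * J (1 / real n) \<omega>)) = exp (- laplace_levy \<nu> \<alpha> / real n)"
proof -
  define Y where "Y i \<omega> = J (real (Suc i) / real n) \<omega> - J (real i / real n) \<omega>" for i \<omega>
  have "indep_vars (\<lambda>_. borel) Y {..<n}"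
    unfolding Y_def by (intro indep_increments) (auto intro!: incseq_SucI divide_right_mono)
  then have ind: "indep_vars (\<lambda>_. borel) (\<lambda>i \<omega>. exp (- \<alpha> * Y i \<omega>)) {..<n}"
    by (rule indep_vars_compose2) measurable
  have [measurable]: "J (real i / real n) \<in> borel_measurable M" for i
    by (rule random_variable_at) auto
  have Y_nonneg: "0 \<le> Y i \<omega>" if "\<omega> \<in> space M" for i \<omega>
    unfolding Y_def using J_mono[OF that, of "real i / real n" "real (Suc i) / real n"]
    by (auto simp: divide_right_mono)
  have "integrable M (\<lambda>\<omega>. exp (- \<alpha> * Y i \<omega>))" for i
  proof (rule integrable_const_bound[of _ 1])
    show "AE \<omega> in M. norm (exp (- \<alpha> * Y i \<omega>)) \<le> 1"
      using Y_nonneg assms by (intro AE_I2) auto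
  qed (simp add: Y_def del: of_nat_Suc)
  then have "expectation (\<lambda>\<omega>. \<Prod>i<n. exp (- \<alpha> * Y i \<omega>)) = (\<Prod>i<n. expectation (\<lambda>\<omega>. exp (- \<alpha> * Y i \<omega>)))"
    by (intro indep_vars_lebesgue_integral ind) auto
  moreover have "(\<Prod>i<n. exp (- \<alpha> * Y i \<omega>)) = exp (- \<alpha> * J 1 \<omega>)" if "\<omega> \<in> space M" for \<omega>
  proof -
    have "(\<Sum>i<n. Y i \<omega>) = J (real n / real n) \<omega> - J (real 0 / real n) \<omega>"
      unfolding Y_def by (rule sum_lessThan_telescope)
    then have "(\<Sum>i<n. Y i \<omega>) = J 1 \<omega>"
      using that assms by (simp add: start)
    then show ?thesis
      by (simp add: exp_sum[symmetric] sum_distrib_left[symmetric] sum_negf)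
  qed
  moreover have "expectation (\<lambda>\<omega>. exp (- \<alpha> * Y i \<omega>)) = expectation (\<lambda>\<omega>. exp (- \<alpha> * J (1 / real n) \<omega>))" for i
    using expectation_increment[of "\<lambda>x. exp (- \<alpha> * x)" "real i / real n" "1 / real n"]
    by (simp add: Y_def add_divide_distrib add.commute)
  ultimately have "expectation (\<lambda>\<omega>. exp (- \<alpha> * J 1 \<omega>)) =
      expectation (\<lambda>\<omega>. exp (- \<alpha> * J (1 / real n) \<omega>)) ^ n"
    by (simp cong: Bochner_Integration.integral_cong)
  then have "expectation (\<lambda>\<omega>. exp (- \<alpha> * J (1 / real n) \<omega>)) ^ n = exp (- laplace_levy \<nu> \<alpha>)"
    using levy_khintchine[OF assms(1)] by (simp add: laplace_levy_def)
  also have "\<dots> = exp (- laplace_levy \<nu> \<alpha> / real n) ^ n"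
    unfolding exp_of_nat_mult[symmetric] using assms by simp
  finally show ?thesis
    by (rule power_eq_imp_eq_base) (simp_all add: Bochner_Integration.integral_nonneg assms)
qed

lemma AE_levy_pos: "AE x in \<nu>. 0 < x"
proof -
  have "{..0} \<in> null_sets \<nu>"
    using levy_measure_pos by (auto simp: null_sets_def sets_levy_measure)
  then show ?thesis
    by (rule AE_I') (auto simp: not_less)
qed

lemma integrable_min_levy: "integrable \<nu> (\<lambda>x. min 1 x)"
proof (rule integrableI_nonneg)
  show "(\<lambda>x. min 1 x) \<in> borel_measurable \<nu>"
    using sets_levy_measure measurable_cong_sets[of \<nu> borel borel borel] by simp
  show "AE x in \<nu>. 0 \<le> min 1 x"
    using AE_levy_pos by eventually_elim simp
  show "(\<integral>\<^sup>+ x. ennreal (min 1 x) \<partial>\<nu>) < \<infinity>"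
    by (rule levy_measure_finite)
qed

text \<open>For positive \<open>x\<close> the integrand is at most \<open>1 / Suc n\<close> and at
  most \<open>x\<close>: the first bound gives the pointwise limit, both together the dominating
  function \<open>min 1 x\<close>. A drift would have added a positive constant to the
  limit.\<close>

lemma laplace_levy_nat_tendsto: "(\<lambda>n. laplace_levy \<nu> (real (Suc n)) / real (Suc n)) \<longlonglongrightarrow> 0"
proof -
  note [measurable_cong] = sets_levy_measure
  have "(\<lambda>n. \<integral>x. (1 - exp (- real (Suc n) * x)) / real (Suc n) \<partial>\<nu>) \<longlonglongrightarrow> (\<integral>x. 0 \<partial>\<nu>)"
  proof (rule integral_dominated_convergence[OF _ _ integrable_min_levy])
    have pos: "0 \<le> (1 - exp (- real (Suc n) * x)) / real (Suc n)"
      and le: "(1 - exp (- real (Suc n) * x)) / real (Suc n) \<le> inverse (real (Suc n))"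
      and le': "(1 - exp (- real (Suc n) * x)) / real (Suc n) \<le> x" if "0 < x" for n x
    proof -
      show "0 \<le> (1 - exp (- real (Suc n) * x)) / real (Suc n)"
      proof (rule divide_nonneg_nonneg)
        have "0 \<le> real (Suc n) * x"
          using that by (intro mult_nonneg_nonneg) auto
        then show "0 \<le> 1 - exp (- real (Suc n) * x)"
          by (simp del: of_nat_Suc)
      qed simp
      show "(1 - exp (- real (Suc n) * x)) / real (Suc n) \<le> inverse (real (Suc n))"
        unfolding inverse_eq_divide by (rule divide_right_mono) (simp_all del: of_nat_Suc)
      have "1 - exp (- real (Suc n) * x) \<le> real (Suc n) * x"
        using exp_ge_add_one_self[of "- real (Suc n) * x"] by linarith
      then show "(1 - exp (- real (Suc n) * x)) / real (Suc n) \<le> x"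
        by (simp add: divide_le_eq mult.commute del: of_nat_Suc)
    qed
    show "AE x in \<nu>. (\<lambda>n. (1 - exp (- real (Suc n) * x)) / real (Suc n)) \<longlonglongrightarrow> 0"
      using AE_levy_pos
    proof eventually_elim
      case (elim x)
      show ?case
        by (rule tendsto_sandwich[OF always_eventually always_eventually tendsto_const LIMSEQ_inverse_real_of_nat])
          (intro allI pos[OF elim] le[OF elim])+
    qed
    show "AE x in \<nu>. norm ((1 - exp (- real (Suc n) * x)) / real (Suc n)) \<le> min 1 x" for n
      using AE_levy_pos
    proof eventually_elim
      case (elim x)
      have "inverse (real (Suc n)) \<le> 1"
        by (simp add: inverse_le_1_iff)
      then have "(1 - exp (- real (Suc n) * x)) / real (Suc n) \<le> 1"
        using le[OF elim, of n] by linarith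
      then show ?case
        unfolding real_norm_def abs_of_nonneg[OF pos[OF elim]] using le'[OF elim, of n] by (rule min.boundedI)
    qed
  qed measurable
  then show ?thesis
    by (simp add: laplace_levy_def)
qed

text \<open>With \<open>h = 1 / Suc n\<close>, the transform of \<open>J h\<close> at the argument
  \<open>1 / h\<close> is \<open>exp (- h * laplace_levy \<nu> (1 / h))\<close> and tends to 1 by
  the previous lemma. Hence \<open>J h / h\<close> tends to 0 in probability.\<close>

lemma expectation_min_J_tendsto:
  "(\<lambda>n. expectation (\<lambda>\<omega>. min 1 (real (Suc n) * J (1 / real (Suc n)) \<omega>))) \<longlonglongrightarrow> 0"
proof -
  \<comment> \<open>Makes \<open>min 1 y\<close> and \<open>C * (1 - exp (- y))\<close> equal at
    \<open>y = 1\<close>. Above 1 monotonicity suffices; below 1, convexity puts \<open>exp\<close>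
    under its chord between \<open>-1\<close> and \<open>0\<close>.\<close>
  define C :: real where "C = 1 / (1 - exp (- 1))"
  have "C > 0"
    by (simp add: C_def)
  have C: "min 1 y \<le> C * (1 - exp (- y))" if "0 \<le> y" for y :: real
  proof (cases "1 \<le> y")
    case True
    then have "exp (- y) \<le> exp (- 1)"
      by simp
    then show ?thesis
      using True by (simp add: C_def le_divide_eq)
  next
    case False
    have "convex_on UNIV (exp :: real \<Rightarrow> real)"
      by (rule exp_convex)
    then have "exp ((1 - y) *\<^sub>R 0 + y *\<^sub>R (- 1)) \<le> (1 - y) * exp 0 + y * exp (- 1 :: real)"
      using that False by (intro convex_onD) auto
    then show ?thesis
      using False by (simp add: C_def le_divide_eq algebra_simps)
  qed
  have up: "expectation (\<lambda>\<omega>. min 1 (real (Suc n) * J (1 / real (Suc n)) \<omega>)) \<le>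
      C * (1 - exp (- (laplace_levy \<nu> (real (Suc n)) / real (Suc n))))" for n
  proof -
    let ?h = "1 / real (Suc n)"
    have [measurable]: "J ?h \<in> borel_measurable M"
      by (rule random_variable_at) simp
    have Jh: "0 \<le> J ?h \<omega>" if "\<omega> \<in> space M" for \<omega>
      using J_nonneg[OF that, of ?h] by simp
    have int: "integrable M (\<lambda>\<omega>. exp (- real (Suc n) * J ?h \<omega>))"
      using Jh by (intro integrable_const_bound[of _ 1]) (auto simp del: of_nat_Suc)
    have "expectation (\<lambda>\<omega>. min 1 (real (Suc n) * J ?h \<omega>)) \<le>
      expectation (\<lambda>\<omega>. C * (1 - exp (- real (Suc n) * J ?h \<omega>)))"
    proof (rule integral_mono)
      show "integrable M (\<lambda>\<omega>. min 1 (real (Suc n) * J ?h \<omega>))"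
        using Jh by (intro integrable_const_bound[of _ 1]) (auto simp del: of_nat_Suc)
      show "min 1 (real (Suc n) * J ?h \<omega>) \<le> C * (1 - exp (- real (Suc n) * J ?h \<omega>))" if "\<omega> \<in> space M" for \<omega>
        using C[of "real (Suc n) * J ?h \<omega>"] Jh[OF that] by (simp del: of_nat_Suc)
    qed (use int in simp)
    also have "\<dots> = C * (1 - expectation (\<lambda>\<omega>. exp (- real (Suc n) * J ?h \<omega>)))"
      using int by (simp add: prob_space)
    finally show ?thesis
      by (subst (asm) laplace_J_inverse_nat) auto
  qed
  have "(\<lambda>n. C * (1 - exp (- (laplace_levy \<nu> (real (Suc n)) / real (Suc n))))) \<longlonglongrightarrow> C * (1 - exp (- 0))"
    by (intro tendsto_intros laplace_levy_nat_tendsto)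
  then have lim: "(\<lambda>n. C * (1 - exp (- (laplace_levy \<nu> (real (Suc n)) / real (Suc n))))) \<longlonglongrightarrow> 0"
    by simp
  show ?thesis
    by (rule tendsto_sandwich[OF _ _ tendsto_const lim])
      (use up J_nonneg in \<open>auto intro!: integral_nonneg_AE AE_I2\<close>)
qed

end

subsection \<open>The Laplace transform of the idle probability\<close>

text \<open>Here \<open>w\<close> and \<open>w'\<close> are the workloads before and after a step
  and \<open>j\<close> is the increment of \<open>J\<close>. For \<open>h \<le> w\<close> nothing is
  reflected and the difference vanishes. The first error term covers \<open>0 < w < h\<close>; for
  \<open>w = 0\<close> the second bounds the excess over \<beta> and the third the deficit.\<close>

lemma reflected_step_rate:
  fixes w j w' h \<beta> :: real
  assumes "0 \<le> w" "0 \<le> j" "0 < h" "0 < \<beta>"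
    and lower: "w + j - h \<le> w'" "0 \<le> w'"
    and upper: "w' \<le> w + j - h + max 0 (h - w)"
  shows "\<bar>(exp (- \<beta> * (w + j - h)) - exp (- \<beta> * w')) / h - \<beta> * of_bool (w = 0)\<bar> \<le>
    \<beta> * exp (\<beta> * h) * of_bool (0 < w \<and> w < h) + \<beta> * (exp (\<beta> * h) - 1) + \<beta> * min 1 (j / h)"
    (is "\<bar>?D / h - _\<bar> \<le> ?A + ?B + ?C")
proof -
  have B: "0 \<le> ?B" and C: "0 \<le> ?C"
    using assms by auto
  have D: "0 \<le> ?D"
    using assms by simp
  consider "h \<le> w" | "0 < w" "w < h" | "w = 0"
    using assms by linarith
  then show ?thesis
  proof cases
    case 1
    then have "w' = w + j - h" "w \<noteq> 0"
      using assms by auto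
    then show ?thesis
      using B C assms by simp
  next
    case 2
    then have "w' \<le> j"
      using upper by simp
    then have "?D \<le> exp (- \<beta> * (w + j - h)) - exp (- \<beta> * j)"
      using assms by simp
    also have "\<dots> = exp (- \<beta> * (w + j - h)) * (1 - exp (- \<beta> * (h - w)))"
      by (simp add: algebra_simps flip: exp_add)
    also have "\<dots> \<le> exp (\<beta> * h) * (\<beta> * h)"
    proof (rule mult_mono)
      have "- \<beta> * (w + j - h) = \<beta> * (h - w - j)"
        by (simp add: algebra_simps)
      also have "\<dots> \<le> \<beta> * h"
        using assms by (intro mult_left_mono) auto
      finally show "exp (- \<beta> * (w + j - h)) \<le> exp (\<beta> * h)"
        by simp
      have "\<beta> * (h - w) \<le> \<beta> * h"
        using assms by (intro mult_left_mono) auto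
      then show "1 - exp (- \<beta> * (h - w)) \<le> \<beta> * h"
        using exp_ge_add_one_self[of "- \<beta> * (h - w)"] by linarith
      show "0 \<le> 1 - exp (- \<beta> * (h - w))"
        using 2 assms by simp
    qed simp
    finally have "?D / h \<le> ?A"
      using 2 assms by (simp add: divide_le_eq mult_ac)
    moreover have "0 \<le> ?D / h"
      using D assms by (intro divide_nonneg_pos) auto
    ultimately show ?thesis
      using B C 2 by (simp del: times_divide_eq_right)
  next
    case 3
    then have w': "w' \<le> j" "j - h \<le> w'" "0 \<le> w'"
      using assms by auto
    have "?D \<le> exp (- \<beta> * (w + j - h)) - exp (- \<beta> * j)"
      using w' assms by simp
    also have "\<dots> = exp (- \<beta> * j) * (exp (\<beta> * h) - 1)"
      using 3 by (simp add: algebra_simps flip: exp_add)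
    also have "\<dots> \<le> 1 * (exp (\<beta> * h) - 1)"
      using assms by (intro mult_right_mono) auto
    also have "\<dots> \<le> \<beta> * h * exp (\<beta> * h)"
      using abs_exp_minus_1_le[of "\<beta> * h"] assms by simp
    finally have "?D / h \<le> \<beta> * exp (\<beta> * h)"
      using assms by (simp add: divide_le_eq mult_ac)
    \<comment> \<open>If \<open>h \<le> j\<close>, then \<open>?C\<close> is \<beta> and the bound
      is trivial. Otherwise \<open>0 \<le> w'\<close> bounds the subtracted exponential by 1, and
      the tangent of \<open>exp\<close> at 0 gives \<open>\<beta> * (h - j)\<close>.\<close>
    moreover have "\<beta> - ?C \<le> ?D / h"
    proof (cases "h \<le> j")
      case True
      then show ?thesis
        using D assms by (auto simp: min_def)
    next
      case False
      have "\<beta> * (h - j) \<le> exp (- \<beta> * (w + j - h)) - 1"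
        using exp_ge_add_one_self[of "- \<beta> * (w + j - h)"] 3 by (simp add: algebra_simps)
      also have "\<dots> \<le> ?D"
        using w' assms by simp
      finally have "\<beta> * (h - j) / h \<le> ?D / h"
        using assms by (intro divide_right_mono) auto
      moreover have "\<beta> * (h - j) / h = \<beta> - ?C"
        using False assms by (simp add: min_def field_simps)
      ultimately show ?thesis
        by simp
    qed
    moreover have "\<beta> * of_bool (w = 0) = \<beta>" "?A = 0"
      using 3 by auto
    moreover have "?B = \<beta> * exp (\<beta> * h) - \<beta>"
      by (simp add: algebra_simps)
    ultimately show ?thesis
      using B C unfolding abs_le_iff by linarith
  qed
qed

text \<open>Negative times are clamped to \<open>0\<close> to obtain a Borel function on the whole
  line, the kind of function that \<open>laplace_moment\<close> takes.\<close>

definition idle_prob :: "'a measure \<Rightarrow> (real \<Rightarrow> 'a \<Rightarrow> real) \<Rightarrow> real \<Rightarrow> real" where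
  "idle_prob M J t = measure M {\<omega> \<in> space M. reflected J (max 0 t) \<omega> = 0}"

lemma (in prob_space) expectation_of_bool:
  assumes "{\<omega> \<in> space M. P \<omega>} \<in> events"
  shows "expectation (\<lambda>\<omega>. of_bool (P \<omega>)) = prob {\<omega> \<in> space M. P \<omega>}"
proof -
  have "expectation (\<lambda>\<omega>. of_bool (P \<omega>)) = expectation (indicator {\<omega> \<in> space M. P \<omega>})"
    by (intro Bochner_Integration.integral_cong) (auto simp: indicator_def)
  also have "\<dots> = prob ({\<omega> \<in> space M. P \<omega>} \<inter> space M)"
    using assms by simp
  also have "{\<omega> \<in> space M. P \<omega>} \<inter> space M = {\<omega> \<in> space M. P \<omega>}"
    by auto
  finally show ?thesis .
qed

context pure_jump_subordinator
begin

lemma measurable_reflected_pair_M: "(\<lambda>(\<omega>, t). reflected J (max 0 t) \<omega>) \<in> borel_measurable (M \<Otimes>\<^sub>M borel)"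
  by (rule measurable_reflected_pair) (auto intro: random_variable_at)

lemma measurable_expectation_reflected:
  fixes f :: "real \<Rightarrow> real"
  assumes [measurable]: "f \<in> borel_measurable borel"
  shows "(\<lambda>t. expectation (\<lambda>\<omega>. f (reflected J (max 0 t) \<omega>))) \<in> borel_measurable borel"
proof -
  have "(\<lambda>(t, \<omega>). f (reflected J (max 0 t) \<omega>)) = (\<lambda>p. f ((\<lambda>(\<omega>, t). reflected J (max 0 t) \<omega>) (snd p, fst p)))"
    by auto
  also have "\<dots> \<in> borel_measurable (borel \<Otimes>\<^sub>M M)"
    by (intro measurable_compose[OF _ assms] measurable_compose[OF _ measurable_reflected_pair_M]) measurable
  finally show ?thesis
    by (intro borel_measurable_lebesgue_integral)
qed

lemma measurable_reflected_M: "0 \<le> t \<Longrightarrow> reflected J t \<in> borel_measurable M"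
  by (rule measurable_reflected) (auto intro: random_variable_at)

lemma idle_prob_eq_expectation:
  "idle_prob M J t = expectation (\<lambda>\<omega>. of_bool (reflected J (max 0 t) \<omega> = 0))"
proof -
  have [measurable]: "reflected J (max 0 t) \<in> borel_measurable M"
    by (rule measurable_reflected_M) simp
  show ?thesis
    unfolding idle_prob_def by (rule expectation_of_bool[symmetric]) measurable
qed

lemma measurable_idle_prob [measurable]: "idle_prob M J \<in> borel_measurable borel"
proof -
  have "(\<lambda>t. expectation (\<lambda>\<omega>. of_bool (reflected J (max 0 t) \<omega> = 0) :: real)) \<in> borel_measurable borel"
    by (rule measurable_expectation_reflected[of "\<lambda>x. of_bool (x = 0)"]) measurable
  then show ?thesis
    unfolding idle_prob_eq_expectation[abs_def] .
qed

lemma idle_prob_bounds: "0 \<le> idle_prob M J t" "idle_prob M J t \<le> 1"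
  by (simp_all add: idle_prob_def)

text \<open>The atom at \<open>0\<close> is excluded, so these events decrease to the empty
  set.\<close>

lemma prob_reflected_small_tendsto:
  assumes "0 \<le> t"
  shows "(\<lambda>n. prob {\<omega> \<in> space M. 0 < reflected J t \<omega> \<and> reflected J t \<omega> < 1 / real (Suc n)}) \<longlonglongrightarrow> 0"
proof -
  let ?A = "\<lambda>n. {\<omega> \<in> space M. 0 < reflected J t \<omega> \<and> reflected J t \<omega> < 1 / real (Suc n)}"
  have [measurable]: "reflected J t \<in> borel_measurable M"
    using assms by (rule measurable_reflected_M)
  have "(\<lambda>n. prob (?A n)) \<longlonglongrightarrow> prob (\<Inter>n. ?A n)"
  proof (rule finite_Lim_measure_decseq)
    show "decseq ?A"
    proof (rule decseq_SucI)
      fix n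
      have "1 / real (Suc (Suc n)) \<le> 1 / real (Suc n)"
        by (simp add: field_simps)
      then show "?A (Suc n) \<subseteq> ?A n"
        by auto
    qed
  qed auto
  moreover have "(\<Inter>n. ?A n) = {}"
  proof (rule ccontr)
    assume "(\<Inter>n. ?A n) \<noteq> {}"
    then obtain \<omega> where "0 < reflected J t \<omega>" "\<And>n. reflected J t \<omega> < 1 / real (Suc n)"
      by blast
    moreover obtain n where "inverse (real (Suc n)) < reflected J t \<omega>"
      using reals_Archimedean[OF \<open>0 < reflected J t \<omega>\<close>] by blast
    ultimately show False
      by (metis inverse_eq_divide less_asym)
  qed
  ultimately show ?thesis
    by simp
qed

section \<open>The rate of the transform and its integral\<close>

text \<open>The expectation of \<open>reflected_step_rate\<close> with \<open>h = 1 / N\<close>. The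
  factor \<open>exp (\<xi> / N)\<close> is what independence and the equation for \<beta> make of
  the step without reflection.\<close>

lemma reflected_transform_rate:
  fixes n :: nat
  assumes \<beta>: "0 < \<beta>" "\<beta> - laplace_levy \<nu> \<beta> = \<xi>" and t: "0 \<le> t"
  defines "g \<equiv> \<lambda>t. expectation (\<lambda>\<omega>. exp (- \<beta> * reflected J t \<omega>))"
    and "N \<equiv> real (Suc n)"
  shows "\<bar>N * (exp (\<xi> / N) * g t - g (t + 1 / N)) - \<beta> * idle_prob M J t\<bar> \<le>
    \<beta> * exp (\<beta> / N) * prob {\<omega> \<in> space M. 0 < reflected J t \<omega> \<and> reflected J t \<omega> < 1 / N} +
    \<beta> * (exp (\<beta> / N) - 1) + \<beta> * expectation (\<lambda>\<omega>. min 1 (N * J (1 / N) \<omega>))"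
proof -
  define h where "h = 1 / N"
  have N: "0 < N" and h: "0 < h" and Nh: "N = 1 / h"
    by (auto simp: N_def h_def)
  let ?W = "\<lambda>t \<omega>. reflected J t \<omega>" and ?j = "\<lambda>\<omega>. J (t + h) \<omega> - J t \<omega>"
  have [measurable]: "reflected J t \<in> borel_measurable M" "reflected J (t + h) \<in> borel_measurable M"
    "J t \<in> borel_measurable M" "J (t + h) \<in> borel_measurable M"
    using t h by (auto intro: random_variable_at measurable_reflected_M)
  have j: "0 \<le> ?j \<omega>" if "\<omega> \<in> space M" for \<omega>
    using J_mono[OF that t, of "t + h"] h by simp
  have int: "integrable M (\<lambda>\<omega>. exp (- \<beta> * X \<omega>))"
    if "\<And>\<omega>. \<omega> \<in> space M \<Longrightarrow> 0 \<le> X \<omega>" "X \<in> borel_measurable M" for X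
    using that \<beta> by (intro integrable_const_bound[of _ 1]) auto
  have int_W: "integrable M (\<lambda>\<omega>. exp (- \<beta> * ?W t \<omega>))" "integrable M (\<lambda>\<omega>. exp (- \<beta> * ?W (t + h) \<omega>))"
    by (rule int; use reflected_nonneg t h in auto)+
  have split: "exp (- \<beta> * (?W t \<omega> + ?j \<omega> - h)) =
      exp (\<beta> * h) * (exp (- \<beta> * ?W t \<omega>) * exp (- \<beta> * ?j \<omega>))" for \<omega>
    by (simp add: algebra_simps flip: exp_add)
  have int_Wj: "integrable M (\<lambda>\<omega>. exp (- \<beta> * (?W t \<omega> + ?j \<omega> - h)))"
  proof -
    have "integrable M (\<lambda>\<omega>. exp (- \<beta> * (?W t \<omega> + ?j \<omega>)))"
      using t j by (intro int add_nonneg_nonneg reflected_nonneg) auto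
    then have "integrable M (\<lambda>\<omega>. exp (\<beta> * h) * exp (- \<beta> * (?W t \<omega> + ?j \<omega>)))"
      by (rule integrable_mult_right)
    also have "(\<lambda>\<omega>. exp (\<beta> * h) * exp (- \<beta> * (?W t \<omega> + ?j \<omega>))) = (\<lambda>\<omega>. exp (- \<beta> * (?W t \<omega> + ?j \<omega> - h)))"
      by (simp add: algebra_simps flip: exp_add)
    finally show ?thesis .
  qed
  have "expectation (\<lambda>\<omega>. exp (- \<beta> * (?W t \<omega> + ?j \<omega> - h))) =
      exp (\<beta> * h) * (g t * expectation (\<lambda>\<omega>. exp (- \<beta> * J h \<omega>)))"
    unfolding split g_def using \<beta> t h
    by (simp only: integral_mult_right_zero expectation_reflected_mult_increment[of \<beta> t h] less_imp_le)
  also have "expectation (\<lambda>\<omega>. exp (- \<beta> * J h \<omega>)) = exp (- laplace_levy \<nu> \<beta> * h)"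
    using laplace_J_inverse_nat[of \<beta> "Suc n"] \<beta> by (simp add: h_def N_def)
  also have "exp (\<beta> * h) * (g t * exp (- laplace_levy \<nu> \<beta> * h)) = exp (\<xi> * h) * g t"
    unfolding \<beta>(2)[symmetric] by (simp add: algebra_simps flip: exp_add)
  finally have E: "expectation (\<lambda>\<omega>. exp (- \<beta> * (?W t \<omega> + ?j \<omega> - h))) = exp (\<xi> * h) * g t" .
  let ?D = "\<lambda>\<omega>. (exp (- \<beta> * (?W t \<omega> + ?j \<omega> - h)) - exp (- \<beta> * ?W (t + h) \<omega>)) / h - \<beta> * of_bool (?W t \<omega> = 0)"
  let ?R = "\<lambda>\<omega>. \<beta> * exp (\<beta> * h) * of_bool (0 < ?W t \<omega> \<and> ?W t \<omega> < h) + \<beta> * (exp (\<beta> * h) - 1) + \<beta> * min 1 (?j \<omega> / h)"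
  have int_W0: "integrable M (\<lambda>\<omega>. of_bool (?W t \<omega> = 0) :: real)"
    and int_Wh: "integrable M (\<lambda>\<omega>. of_bool (0 < ?W t \<omega> \<and> ?W t \<omega> < h) :: real)"
    by (intro integrable_const_bound[of _ 1]; auto)+
  have int_min: "integrable M (\<lambda>\<omega>. min 1 (?j \<omega> / h))"
    using j h by (intro integrable_const_bound[of _ 1]) auto
  have D: "(exp (\<xi> * h) * g t - g (t + h)) / h - \<beta> * idle_prob M J t = expectation ?D"
  proof -
    have "expectation ?D = (expectation (\<lambda>\<omega>. exp (- \<beta> * (?W t \<omega> + ?j \<omega> - h))) - g (t + h)) / h -
        \<beta> * expectation (\<lambda>\<omega>. of_bool (?W t \<omega> = 0))"
      unfolding g_def using int_W int_Wj int_W0 by simp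
    then show ?thesis
      unfolding E using t by (simp add: idle_prob_eq_expectation max_def)
  qed
  have D_le: "\<bar>expectation ?D\<bar> \<le> expectation ?R"
  proof -
    have "\<bar>expectation ?D\<bar> \<le> expectation (\<lambda>\<omega>. \<bar>?D \<omega>\<bar>)"
      by (rule integral_abs_bound)
    also have "\<dots> \<le> expectation ?R"
    proof (rule integral_mono)
      show "integrable M (\<lambda>\<omega>. \<bar>?D \<omega>\<bar>)"
        using int_W int_Wj int_W0 by (intro integrable_abs) simp
      show "integrable M ?R"
        using int_Wh int_min by simp
      fix \<omega> assume \<omega>: "\<omega> \<in> space M"
      show "\<bar>?D \<omega>\<bar> \<le> ?R \<omega>"
        using \<beta> t h j[OF \<omega>] reflected_step_ge[OF \<omega> t, of h] reflected_step_le[OF \<omega> t, of h]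
        by (intro reflected_step_rate) (auto intro!: reflected_nonneg[OF \<omega>])
    qed
    finally show ?thesis .
  qed
  have R: "expectation ?R = \<beta> * exp (\<beta> * h) * prob {\<omega> \<in> space M. 0 < ?W t \<omega> \<and> ?W t \<omega> < h} +
      \<beta> * (exp (\<beta> * h) - 1) + \<beta> * expectation (\<lambda>\<omega>. min 1 (?j \<omega> / h))"
  proof -
    have "expectation (\<lambda>\<omega>. of_bool (0 < ?W t \<omega> \<and> ?W t \<omega> < h)) =
        prob {\<omega> \<in> space M. 0 < ?W t \<omega> \<and> ?W t \<omega> < h}"
      by (rule expectation_of_bool) measurable
    then show ?thesis
      using int_Wh int_min by (simp add: prob_space)
  qed
  have "expectation (\<lambda>\<omega>. min 1 (?j \<omega> / h)) = expectation (\<lambda>\<omega>. min 1 (J h \<omega> / h))"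
    using expectation_increment[of "\<lambda>x. min 1 (x / h)" t h] t h by simp
  with D_le have "\<bar>(exp (\<xi> * h) * g t - g (t + h)) / h - \<beta> * idle_prob M J t\<bar> \<le>
      \<beta> * exp (\<beta> * h) * prob {\<omega> \<in> space M. 0 < ?W t \<omega> \<and> ?W t \<omega> < h} +
      \<beta> * (exp (\<beta> * h) - 1) + \<beta> * expectation (\<lambda>\<omega>. min 1 (J h \<omega> / h))"
    unfolding D R by (simp only:)
  moreover have "x / h = N * x" "x * h = x / N" for x
    by (simp_all add: h_def)
  ultimately show ?thesis
    unfolding h_def[symmetric] by (simp only:)
qed

text \<open>Dominated convergence under the Laplace integral needs a bound free of \<open>n\<close>
  and \<open>t\<close> besides the limit. Each of the three error terms is at most
  \<open>\<beta> * exp \<beta>\<close>, and the limit itself is at most \<beta>.\<close>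

lemma reflected_transform_rate_tendsto:
  assumes \<beta>: "0 < \<beta>" "\<beta> - laplace_levy \<nu> \<beta> = \<xi>" and t: "0 \<le> t"
  defines "g \<equiv> \<lambda>t. expectation (\<lambda>\<omega>. exp (- \<beta> * reflected J t \<omega>))"
  defines "r \<equiv> \<lambda>n. real (Suc n) * (exp (\<xi> / real (Suc n)) * g t - g (t + 1 / real (Suc n)))"
  shows "r \<longlonglongrightarrow> \<beta> * idle_prob M J t" and "\<bar>r n\<bar> \<le> 3 * \<beta> * exp \<beta> + \<beta>"
proof -
  define P where "P n = prob {\<omega> \<in> space M. 0 < reflected J t \<omega> \<and> reflected J t \<omega> < 1 / real (Suc n)}" for n
  define K where "K n = expectation (\<lambda>\<omega>. min 1 (real (Suc n) * J (1 / real (Suc n)) \<omega>))" for n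
  define b where "b n = \<beta> * exp (\<beta> / real (Suc n)) * P n + \<beta> * (exp (\<beta> / real (Suc n)) - 1) + \<beta> * K n" for n
  have r: "\<bar>r n - \<beta> * idle_prob M J t\<bar> \<le> b n" for n
    unfolding r_def b_def P_def K_def g_def by (rule reflected_transform_rate[OF \<beta> t])
  have 0: "(\<lambda>n. x / real (Suc n)) \<longlonglongrightarrow> 0" for x :: real
    using tendsto_mult[OF tendsto_const LIMSEQ_inverse_real_of_nat, of x] by (simp add: divide_inverse)
  have "b \<longlonglongrightarrow> \<beta> * exp 0 * 0 + \<beta> * (exp 0 - 1) + \<beta> * 0"
    unfolding b_def P_def K_def
    by (intro tendsto_intros 0 prob_reflected_small_tendsto[OF t] expectation_min_J_tendsto)
  then have "b \<longlonglongrightarrow> 0"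
    by simp
  then have "(\<lambda>n. r n - \<beta> * idle_prob M J t) \<longlonglongrightarrow> 0"
    by (rule Lim_null_comparison[rotated]) (simp add: r)
  then show "r \<longlonglongrightarrow> \<beta> * idle_prob M J t"
    by (simp add: LIM_zero_iff)
  have "\<beta> / real (Suc n) \<le> \<beta>"
    using \<beta> by (simp add: field_simps)
  then have e: "exp (\<beta> / real (Suc n)) \<le> exp \<beta>"
    by simp
  have "P n \<le> 1"
    by (simp add: P_def)
  have "K n \<le> expectation (\<lambda>_. 1)"
    unfolding K_def
  proof (rule integral_mono)
    have [measurable]: "J (1 / real (Suc n)) \<in> borel_measurable M"
      by (rule random_variable_at) simp
    show "integrable M (\<lambda>\<omega>. min 1 (real (Suc n) * J (1 / real (Suc n)) \<omega>))"
      by (intro integrable_const_bound[of _ 1]) (auto simp: J_nonneg simp del: of_nat_Suc)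
  qed auto
  then have "K n \<le> 1"
    by (simp add: prob_space)
  have "\<beta> * exp (\<beta> / real (Suc n)) * P n \<le> \<beta> * exp \<beta> * 1"
    using \<beta> e \<open>P n \<le> 1\<close> by (intro mult_mono) (auto simp: P_def)
  moreover have "\<beta> * (exp (\<beta> / real (Suc n)) - 1) \<le> \<beta> * exp \<beta>"
    by (rule mult_left_mono) (use e \<beta> in linarith)+
  moreover have "\<beta> * K n \<le> \<beta> * 1"
    using \<beta> \<open>K n \<le> 1\<close> by (intro mult_left_mono) auto
  moreover have "\<beta> * idle_prob M J t \<le> \<beta> * 1" "0 \<le> \<beta> * idle_prob M J t"
    using idle_prob_bounds \<beta> by (auto intro!: mult_left_mono)
  moreover have "\<beta> * 1 \<le> \<beta> * exp \<beta>"
    using \<beta> by (intro mult_left_mono) auto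
  ultimately show "\<bar>r n\<bar> \<le> 3 * \<beta> * exp \<beta> + \<beta>"
    using r[of n] unfolding b_def by linarith
qed

text \<open>The integral of \<open>N * (G t - G (t + 1 / N))\<close> over the half-line is evaluated
  twice. Dominated convergence gives the left-hand side; shifting the second half leaves
  \<open>N\<close> times the integral of \<open>G\<close> over \<open>[0, 1 / N)\<close>, which
  tends to \<open>G 0 = 1\<close>.\<close>

lemma laplace_idle_prob:
  assumes \<beta>: "0 < \<beta>" "\<beta> - laplace_levy \<nu> \<beta> = \<xi>" and "0 < \<xi>"
  shows "\<beta> * laplace_moment (idle_prob M J) 0 \<xi> = 1"
proof -
  define G where "G t = exp (- \<xi> * t) * expectation (\<lambda>\<omega>. exp (- \<beta> * reflected J (max 0 t) \<omega>))" for t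
  have [measurable]: "G \<in> borel_measurable borel"
    unfolding G_def
    by (intro borel_measurable_times measurable_expectation_reflected[of "\<lambda>x. exp (- \<beta> * x)"]) measurable
  have G_bound: "0 \<le> G t" "G t \<le> exp (- \<xi> * t)" for t
  proof -
    have [measurable]: "reflected J (max 0 t) \<in> borel_measurable M"
      by (rule measurable_reflected_M) simp
    have "expectation (\<lambda>\<omega>. exp (- \<beta> * reflected J (max 0 t) \<omega>)) \<le> expectation (\<lambda>_. 1)"
      using \<beta>(1) by (intro integral_mono integrable_const_bound[of _ 1]) (auto simp: reflected_nonneg)
    then show "0 \<le> G t" "G t \<le> exp (- \<xi> * t)"
      unfolding G_def by (auto simp: prob_space mult_left_le intro!: mult_nonneg_nonneg integral_nonneg_AE)
  qed
  have int_G: "integrable lborel (\<lambda>t. indicator {a..} t * G t)" if "0 \<le> a" for a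
  proof (rule Bochner_Integration.integrable_bound[OF integrable_power_exp[OF \<open>0 < \<xi>\<close>, of 0]])
    show "AE t in lborel. norm (indicator {a..} t * G t) \<le> norm (indicator {0..} t * (t ^ 0 * exp (- \<xi> * t)))"
      using G_bound that by (auto simp: indicator_def)
  qed simp
  define u where "u n t = indicator {0..} t * (real (Suc n) * (G t - G (t + 1 / real (Suc n))))" for n t
  \<comment> \<open>Drawing out the discount factor of the later time \<open>t + 1 / Suc n\<close>
    leaves exactly the rate of the preceding lemma.\<close>
  have u_eq: "u n t = indicator {0..} t * (exp (- \<xi> * (t + 1 / real (Suc n))) *
      (real (Suc n) * (exp (\<xi> / real (Suc n)) * expectation (\<lambda>\<omega>. exp (- \<beta> * reflected J t \<omega>)) -
       expectation (\<lambda>\<omega>. exp (- \<beta> * reflected J (t + 1 / real (Suc n)) \<omega>)))))" for n t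
  proof (cases "0 \<le> t")
    case True
    have "exp (- \<xi> * (t + 1 / real (Suc n))) * exp (\<xi> / real (Suc n)) = exp (- \<xi> * t)"
      by (simp add: algebra_simps flip: exp_add)
    moreover have "max 0 t = t" "max 0 (t + 1 / real (Suc n)) = t + 1 / real (Suc n)"
      using True by (auto simp: max_def)
    moreover have "a * (N * (b * x - y)) = N * (a * b * x - a * y)" for a b x y N :: real
      by (simp add: algebra_simps)
    ultimately show ?thesis
      unfolding u_def G_def by (simp only:)
  qed (simp add: u_def)
  have "(\<lambda>n. \<integral>t. u n t \<partial>lborel) \<longlonglongrightarrow> (\<integral>t. \<beta> * (indicator {0..} t * ((- t) ^ 0 * exp (- \<xi> * t) * idle_prob M J t)) \<partial>lborel)"
  proof (rule integral_dominated_convergence)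
    show "integrable lborel (\<lambda>t. indicator {0..} t * (t ^ 0 * exp (- \<xi> * t)) * (3 * \<beta> * exp \<beta> + \<beta>))"
      using integrable_power_exp[OF \<open>0 < \<xi>\<close>, of 0] by (rule integrable_mult_left)
    show "AE t in lborel. (\<lambda>n. u n t) \<longlonglongrightarrow> \<beta> * (indicator {0..} t * ((- t) ^ 0 * exp (- \<xi> * t) * idle_prob M J t))"
    proof (rule AE_I2)
      fix t :: real
      show "(\<lambda>n. u n t) \<longlonglongrightarrow> \<beta> * (indicator {0..} t * ((- t) ^ 0 * exp (- \<xi> * t) * idle_prob M J t))"
      proof (cases "0 \<le> t")
        case True
        have 0: "(\<lambda>n. 1 / real (Suc n)) \<longlonglongrightarrow> 0"
          using LIMSEQ_inverse_real_of_nat by (simp add: inverse_eq_divide)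
        have "(\<lambda>n. u n t) \<longlonglongrightarrow> indicator {0..} t * (exp (- \<xi> * (t + 0)) * (\<beta> * idle_prob M J t))"
          unfolding u_eq
          by (intro tendsto_mult tendsto_const tendsto_exp tendsto_add 0
              reflected_transform_rate_tendsto(1)[OF \<beta> True])
        then show ?thesis
          by (simp add: mult_ac)
      qed (simp add: u_def)
    qed
    show "AE t in lborel. norm (u n t) \<le> indicator {0..} t * (t ^ 0 * exp (- \<xi> * t)) * (3 * \<beta> * exp \<beta> + \<beta>)" for n
    proof (rule AE_I2)
      fix t :: real
      show "norm (u n t) \<le> indicator {0..} t * (t ^ 0 * exp (- \<xi> * t)) * (3 * \<beta> * exp \<beta> + \<beta>)"
      proof (cases "0 \<le> t")
        case True
        have "exp (- \<xi> * (t + 1 / real (Suc n))) \<le> exp (- \<xi> * t)"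
          using \<open>0 < \<xi>\<close> by simp
        then show ?thesis
          unfolding u_eq real_norm_def abs_mult using True
          by (simp only: abs_exp_cancel indicator_simps atLeast_iff abs_one mult_1 power_0)
            (intro mult_mono reflected_transform_rate_tendsto(2)[OF \<beta> True, unfolded abs_mult]; simp)
      qed (simp add: u_def)
    qed
    show "u n \<in> borel_measurable lborel" for n
      unfolding u_def by measurable
  qed measurable
  also have "(\<integral>t. \<beta> * (indicator {0..} t * ((- t) ^ 0 * exp (- \<xi> * t) * idle_prob M J t)) \<partial>lborel) =
      \<beta> * laplace_moment (idle_prob M J) 0 \<xi>"
    unfolding laplace_moment_def by (rule integral_mult_right_zero)
  finally have lim1: "(\<lambda>n. \<integral>t. u n t \<partial>lborel) \<longlonglongrightarrow> \<beta> * laplace_moment (idle_prob M J) 0 \<xi>" .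
  \<comment> \<open>The shift cancels everything outside \<open>[0, h)\<close>; substituting
    \<open>t = h * s\<close> turns the mean of \<open>G\<close> over this shrinking interval into an
    integral over the fixed \<open>[0, 1)\<close>.\<close>
  have u_int: "(\<integral>t. u n t \<partial>lborel) = (\<integral>s. indicator {0..<1} s * G (s / real (Suc n)) \<partial>lborel)" for n
  proof -
    define h where "h = 1 / real (Suc n)"
    have h: "0 < h" "real (Suc n) = 1 / h"
      by (auto simp: h_def)
    have shift: "(\<lambda>t. indicator {0..} t * G (t + h)) = (\<lambda>t. indicator {h..} (h + 1 * t) * G (h + 1 * t))"
      by (auto simp: fun_eq_iff indicator_def add.commute)
    have int_shift: "integrable lborel (\<lambda>t. indicator {0..} t * G (t + h))"
      unfolding shift using int_G[of h] h by (subst lborel_integrable_real_affine_iff) auto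
    have "(\<integral>t. u n t \<partial>lborel) = (\<integral>t. (indicator {0..} t * G t - indicator {0..} t * G (t + h)) / h \<partial>lborel)"
      unfolding u_def h(2) by (intro Bochner_Integration.integral_cong) (auto simp: diff_divide_distrib right_diff_distrib)
    also have "\<dots> = ((\<integral>t. indicator {0..} t * G t \<partial>lborel) - (\<integral>t. indicator {0..} t * G (t + h) \<partial>lborel)) / h"
      unfolding integral_divide_zero using int_G[of 0] int_shift
      by (subst Bochner_Integration.integral_diff) auto
    also have "(\<integral>t. indicator {0..} t * G (t + h) \<partial>lborel) = (\<integral>t. indicator {h..} t * G t \<partial>lborel)"
      unfolding shift using lborel_integral_real_affine[of 1 "\<lambda>t. indicator {h..} t * G t" h] by simp
    also have "(\<integral>t. indicator {0..} t * G t \<partial>lborel) - (\<integral>t. indicator {h..} t * G t \<partial>lborel) =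
        (\<integral>t. indicator {0..<h} t * G t \<partial>lborel)"
    proof (subst Bochner_Integration.integral_diff[symmetric])
      show "(\<integral>t. indicator {0..} t * G t - indicator {h..} t * G t \<partial>lborel) = (\<integral>t. indicator {0..<h} t * G t \<partial>lborel)"
        using h by (intro Bochner_Integration.integral_cong) (auto simp: indicator_def)
    qed (use int_G h in auto)
    also have "\<dots> = h * (\<integral>s. indicator {0..<h} (0 + h * s) * G (0 + h * s) \<partial>lborel)"
      using h lborel_integral_real_affine[of h "\<lambda>t. indicator {0..<h} t * G t" 0] by simp
    also have "(\<lambda>s. indicator {0..<h} (0 + h * s) * G (0 + h * s)) = (\<lambda>s. indicator {0..<1} s * G (s / real (Suc n)))"
      using h by (auto simp: fun_eq_iff indicator_def zero_le_mult_iff mult.commute)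
    finally show ?thesis
      using h by simp
  qed
  have "(\<lambda>n. \<integral>s. indicator {0..<1} s * G (s / real (Suc n)) \<partial>lborel) \<longlonglongrightarrow> (\<integral>s. indicator {0..<1} s * 1 \<partial>(lborel :: real measure))"
  proof (rule integral_dominated_convergence[where w = "indicator {0..<1}"])
    show "AE s in lborel. (\<lambda>n. indicator {0..<1} s * G (s / real (Suc n))) \<longlonglongrightarrow> indicator {0..<1} s * 1"
    proof (rule AE_I2)
      fix s :: real
      show "(\<lambda>n. indicator {0..<1} s * G (s / real (Suc n))) \<longlonglongrightarrow> indicator {0..<1} s * 1"
      proof (cases "0 \<le> s")
        case True
        define v where "v n = s / real (Suc n)" for n
        have v: "v \<longlonglongrightarrow> 0" "0 \<le> v n" for n
          using tendsto_mult[OF tendsto_const LIMSEQ_inverse_real_of_nat, of s] True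
          by (auto simp: v_def[abs_def] divide_inverse)
        \<comment> \<open>The reflected process starts at \<open>0\<close> and is right-continuous
          there, so its transform is right-continuous at time \<open>0\<close> with value 1.\<close>
        have "(\<lambda>n. expectation (\<lambda>\<omega>. exp (- \<beta> * reflected J (v n) \<omega>))) \<longlonglongrightarrow> expectation (\<lambda>_. exp (- \<beta> * 0))"
        proof (rule integral_dominated_convergence[where w = "\<lambda>_. 1"])
          show "AE \<omega> in M. (\<lambda>n. exp (- \<beta> * reflected J (v n) \<omega>)) \<longlonglongrightarrow> exp (- \<beta> * 0)"
          proof (rule AE_I2)
            fix \<omega> assume "\<omega> \<in> space M"
            then have "(\<lambda>n. reflected J (v n) \<omega>) \<longlonglongrightarrow> 0"
              using reflected_right_continuous[of \<omega> 0 v] v reflected_0 by simp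
            then show "(\<lambda>n. exp (- \<beta> * reflected J (v n) \<omega>)) \<longlonglongrightarrow> exp (- \<beta> * 0)"
              by (intro tendsto_intros)
          qed
          show "(\<lambda>\<omega>. exp (- \<beta> * reflected J (v n) \<omega>)) \<in> borel_measurable M" for n
          proof -
            have [measurable]: "reflected J (v n) \<in> borel_measurable M"
              using v by (intro measurable_reflected_M)
            show ?thesis by measurable
          qed
          show "AE \<omega> in M. norm (exp (- \<beta> * reflected J (v n) \<omega>)) \<le> 1" for n
            using \<beta> v by (auto simp: reflected_nonneg)
        qed simp_all
        then have "(\<lambda>n. exp (- \<xi> * v n) * expectation (\<lambda>\<omega>. exp (- \<beta> * reflected J (v n) \<omega>))) \<longlonglongrightarrow>
            exp (- \<xi> * 0) * expectation (\<lambda>_. exp (- \<beta> * 0))"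
          by (intro tendsto_mult tendsto_exp tendsto_const v)
        moreover have "max 0 (v n) = v n" for n
          using v by simp
        ultimately have "(\<lambda>n. G (v n)) \<longlonglongrightarrow> 1"
          by (simp add: G_def prob_space)
        then show ?thesis
          unfolding v_def by (intro tendsto_mult tendsto_const)
      qed simp
    qed
    show "AE s in lborel. norm (indicator {0..<1} s * G (s / real (Suc n))) \<le> indicator {0..<1} s" for n
    proof (rule AE_I2)
      fix s :: real
      have "G (s / real (Suc n)) \<le> 1" if "0 \<le> s"
      proof -
        have "exp (- \<xi> * (s / real (Suc n))) \<le> 1"
          using that \<open>0 < \<xi>\<close> by (simp del: of_nat_Suc)
        then show ?thesis
          using G_bound(2) order_trans by blast
      qed
      then show "norm (indicator {0..<1} s * G (s / real (Suc n))) \<le> indicator {0..<1} s"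
        using G_bound(1) by (simp add: indicator_def del: of_nat_Suc)
    qed
  qed auto
  then have "(\<lambda>n. \<integral>t. u n t \<partial>lborel) \<longlonglongrightarrow> 1"
    by (simp add: u_int)
  with lim1 show ?thesis
    by (rule LIMSEQ_unique)
qed

section \<open>The Laplace exponent and its inverse\<close>

lemma laplace_exponent_eq:
  assumes "0 \<le> \<alpha>"
  shows "laplace_exponent M J \<alpha> = \<alpha> - laplace_levy \<nu> \<alpha>"
proof -
  have "(\<integral>\<omega>. exp (- \<alpha> * net_input J 1 \<omega>) \<partial>M) = (\<integral>\<omega>. exp \<alpha> * exp (- \<alpha> * J 1 \<omega>) \<partial>M)"
    by (simp add: net_input_def algebra_simps flip: exp_add)
  also have "\<dots> = exp (\<alpha> - laplace_levy \<nu> \<alpha>)"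
    using levy_khintchine[OF assms] by (simp add: laplace_levy_def exp_diff exp_minus divide_inverse)
  finally show ?thesis
    by (simp add: laplace_exponent_def)
qed

text \<open>Continuity is derived for the expectation, whose integrand is bounded by 1, instead of
  the integral against \<nu>, which may be an infinite measure.\<close>

lemma continuous_on_laplace_exponent: "continuous_on {0..} (laplace_exponent M J)"
proof -
  have [measurable]: "J 1 \<in> borel_measurable M"
    by (rule random_variable_at) simp
  let ?E = "\<lambda>\<alpha>. expectation (\<lambda>\<omega>. exp (- \<alpha> * J 1 \<omega>))"
  have "continuous_on {0..} ?E"
    unfolding continuous_on_sequentially comp_def
  proof (intro allI ballI impI)
    fix x :: "nat \<Rightarrow> real" and a assume x: "(\<forall>n. x n \<in> {0..}) \<and> x \<longlonglongrightarrow> a"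
    show "(\<lambda>n. ?E (x n)) \<longlonglongrightarrow> ?E a"
    proof (rule integral_dominated_convergence[where w = "\<lambda>_. 1"])
      show "AE \<omega> in M. (\<lambda>n. exp (- x n * J 1 \<omega>)) \<longlonglongrightarrow> exp (- a * J 1 \<omega>)"
        using x by (intro AE_I2 tendsto_intros) auto
      show "AE \<omega> in M. norm (exp (- x n * J 1 \<omega>)) \<le> 1" for n
        using x by (intro AE_I2) (auto simp: J_nonneg)
    qed simp_all
  qed
  then have "continuous_on {0..} (\<lambda>\<alpha>. \<alpha> + ln (?E \<alpha>))"
    using levy_khintchine by (intro continuous_intros) auto
  moreover have "\<alpha> + ln (?E \<alpha>) = laplace_exponent M J \<alpha>" if "0 \<le> \<alpha>" for \<alpha>
    using that levy_khintchine[OF that] by (simp add: laplace_exponent_eq laplace_levy_def)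
  ultimately show ?thesis
    by (subst continuous_on_cong[OF refl, of _ _ "\<lambda>\<alpha>. \<alpha> + ln (?E \<alpha>)"]) auto
qed

lemma laplace_exponent_attains:
  assumes "0 < \<xi>"
  obtains \<beta> where "0 < \<beta>" "laplace_exponent M J \<beta> = \<xi>"
proof -
  have 0: "laplace_exponent M J 0 = 0"
    by (simp add: laplace_exponent_eq laplace_levy_def)
  have "\<forall>\<^sub>F n in sequentially. laplace_levy \<nu> (real (Suc n)) / real (Suc n) < 1 / 2"
    by (rule order_tendstoD[OF laplace_levy_nat_tendsto]) simp
  then obtain n0 where n0: "\<And>n. n \<ge> n0 \<Longrightarrow> laplace_levy \<nu> (real (Suc n)) / real (Suc n) < 1 / 2"
    by (auto simp: eventually_sequentially)
  obtain n1 where n1: "2 * \<xi> \<le> real n1"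
    using real_arch_simple by blast
  \<comment> \<open>\<open>n0\<close> makes the jump part at \<open>b\<close> less than
    \<open>b / 2\<close>, and \<open>n1\<close> makes \<open>b / 2\<close> at least \<xi>; hence
    \<phi> has risen to \<xi> by \<open>b\<close>.\<close>
  define n where "n = max n0 n1"
  define b where "b = real (Suc n)"
  have b: "0 < b" "2 * \<xi> \<le> b" "laplace_levy \<nu> b / b < 1 / 2"
    using n1 n0[of n] by (auto simp: b_def n_def)
  then have "\<xi> \<le> laplace_exponent M J b"
    by (simp add: laplace_exponent_eq field_simps)
  then obtain \<beta> where "0 \<le> \<beta>" "laplace_exponent M J \<beta> = \<xi>"
    using IVT'[of "laplace_exponent M J" 0 \<xi> b] 0 b assms
      continuous_on_subset[OF continuous_on_laplace_exponent, of "{0..b}"] by fastforce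
  moreover from this have "\<beta> \<noteq> 0"
    using 0 assms by auto
  ultimately show thesis
    using that[of \<beta>] by simp
qed

text \<open>All positive roots have the same reciprocal, the transform at \<xi>, so uniqueness comes
  without convexity or monotonicity of the exponent.\<close>

lemma inverse_exponent_eq:
  assumes "0 < \<xi>"
  shows "inverse_exponent M J \<xi> * laplace_moment (idle_prob M J) 0 \<xi> = 1"
proof -
  obtain \<beta> where \<beta>: "0 < \<beta>" "laplace_exponent M J \<beta> = \<xi>"
    using laplace_exponent_attains[OF assms] .
  have *: "\<gamma> * laplace_moment (idle_prob M J) 0 \<xi> = 1" if "0 < \<gamma>" "laplace_exponent M J \<gamma> = \<xi>" for \<gamma>
    using that assms by (intro laplace_idle_prob) (auto simp: laplace_exponent_eq)
  have "inverse_exponent M J \<xi> = \<beta>"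
    unfolding inverse_exponent_def
  proof (rule the_equality)
    fix \<gamma> assume "0 < \<gamma> \<and> laplace_exponent M J \<gamma> = \<xi>"
    then show "\<gamma> = \<beta>"
      using *[of \<gamma>] *[OF \<beta>] by (metis mult_cancel_right zero_neq_one mult_zero_right)
  qed (use \<beta> in simp)
  with * \<beta> show ?thesis
    by simp
qed

end

subsection \<open>Sampling at Poisson epochs\<close>

context sampled_workload
begin

text \<open>The regulator is nonnegative and so wins the maximum against an empty start. The clamp
  matches the one in \<open>idle_prob\<close>.\<close>

lemma sampled_zero_iff:
  assumes "\<omega> \<in> space M" "0 < \<xi>" "V0 \<omega> = 0"
  shows "sampled J V0 (T \<xi>) k \<omega> = reflected J (max 0 (sampling_epoch (T \<xi>) k \<omega>)) \<omega>"
proof -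
  have "0 \<le> sampling_epoch (T \<xi>) k \<omega>"
    unfolding sampling_epoch_def using assms times_pos by (intro sum_nonneg) (auto intro: less_imp_le)
  then show ?thesis
    using assms regulator_nonneg[of \<omega> "sampling_epoch (T \<xi>) k \<omega>"]
    by (simp add: sampled_def workload_def reflected_def max_def)
qed

lemma sampling_epoch_distributed:
  assumes "0 < \<xi>" "1 \<le> k"
  shows "distributed M lborel (sampling_epoch (T \<xi>) k) (erlang_density (k - 1) \<xi>)"
proof -
  have "distributed M lborel (\<lambda>\<omega>. \<Sum>i\<in>{1..k}. T \<xi> i \<omega>) (erlang_density (card {1..k} - 1) \<xi>)"
    using assms times_exponential indep_vars_subset[OF times_iid[OF assms(1)], of "{1..k}"]
    by (intro exponential_distributed_sum) auto
  then show ?thesis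
    by (simp add: sampling_epoch_def[abs_def])
qed

text \<open>By right continuity the idle event lies in the sigma-algebra generated by the path, so
  \<open>initial_indep\<close> applies to it.\<close>

lemma prob_idle_and_initially_empty:
  assumes "0 \<le> t"
  shows "prob {\<omega> \<in> space M. reflected J t \<omega> = 0 \<and> V0 \<omega> = 0} =
    idle_prob M J t * prob {\<omega> \<in> space M. V0 \<omega> = 0}"
proof -
  let ?N = "vimage_algebra (space M) (path J) path_space"
  let ?K = "vimage_algebra (space M) V0 borel"
  have "J s \<in> borel_measurable ?N" if "0 \<le> s" for s
  proof -
    have "(\<lambda>\<omega>. path J \<omega> s) \<in> borel_measurable ?N"
      using that
      by (intro measurable_compose[OF measurable_vimage_algebra1 measurable_component_singleton])
        (auto simp: path_def space_PiM split: if_splits)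
    then show ?thesis
      using that by (simp add: path_def)
  qed
  then have [measurable]: "reflected J t \<in> borel_measurable ?N"
    using assms by (intro measurable_reflected) auto
  have [measurable]: "V0 \<in> borel_measurable ?K"
    by (intro measurable_vimage_algebra1) auto
  have "{\<omega> \<in> space ?N. reflected J t \<omega> = 0} \<in> sets ?N" "{\<omega> \<in> space ?K. V0 \<omega> = 0} \<in> sets ?K"
    by measurable
  then have "prob ({\<omega> \<in> space M. reflected J t \<omega> = 0} \<inter> {\<omega> \<in> space M. V0 \<omega> = 0}) =
      prob {\<omega> \<in> space M. reflected J t \<omega> = 0} * prob {\<omega> \<in> space M. V0 \<omega> = 0}"
    by (intro indep_setD[OF initial_indep]) auto
  moreover have "{\<omega> \<in> space M. reflected J t \<omega> = 0} \<inter> {\<omega> \<in> space M. V0 \<omega> = 0} =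
      {\<omega> \<in> space M. reflected J t \<omega> = 0 \<and> V0 \<omega> = 0}"
    by auto
  ultimately show ?thesis
    using assms by (simp add: idle_prob_def max_def)
qed

text \<open>The outcome itself, seen through the sigma-algebra of path and initial workload, serves
  as the random element independent of the epoch. On the product space \<open>path_space\<close> the
  infimum over an interval would not be measurable; on \<open>space M\<close> every path is
  right-continuous.\<close>

lemma distr_path_epoch:
  fixes k :: nat
  assumes "0 < \<xi>"
  defines "N \<equiv> vimage_algebra (space M) (\<lambda>\<omega>. (path J \<omega>, V0 \<omega>)) (path_space \<Otimes>\<^sub>M borel)"
    and "S \<equiv> sampling_epoch (T \<xi>) k"
  shows "(\<lambda>\<omega>. \<omega>) \<in> measurable M N" and "S \<in> borel_measurable M"
    and "distr M N (\<lambda>\<omega>. \<omega>) \<Otimes>\<^sub>M distr M borel S = distr M (N \<Otimes>\<^sub>M borel) (\<lambda>\<omega>. (\<omega>, S \<omega>))"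
proof -
  let ?T = "\<lambda>\<omega>. \<lambda>i\<in>{1..}. T \<xi> i \<omega>"
  let ?P = "Pi\<^sub>M {1..} (\<lambda>_ :: nat. borel :: real measure)"
  let ?A = "vimage_algebra (space M) ?T ?P"
  have [measurable]: "V0 \<in> borel_measurable M"
    by (rule initial_measurable)
  have [measurable]: "path J \<in> measurable M path_space"
    unfolding path_def by (intro measurable_restrict random_variable_at) auto
  show id [measurable]: "(\<lambda>\<omega>. \<omega>) \<in> measurable M N"
    unfolding N_def by (intro measurable_vimage_algebra2) auto
  have T: "?T \<in> measurable M ?P"
    using times_exponential[OF assms(1)]
    by (intro measurable_restrict) (auto simp: distributed_def)
  have S_A: "S \<in> borel_measurable ?A"
  proof -
    have "(\<lambda>\<omega>. \<Sum>i=1..k. ?T \<omega> i) \<in> borel_measurable ?A"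
      by (intro borel_measurable_sum measurable_compose[OF measurable_vimage_algebra1 measurable_component_singleton])
        (auto simp: space_PiM split: if_splits)
    then show ?thesis
      by (simp add: S_def sampling_epoch_def[abs_def])
  qed
  have "(\<lambda>\<omega>. \<omega>) \<in> measurable M ?A"
    using T by (intro measurable_vimage_algebra2) auto
  then show S [measurable]: "S \<in> borel_measurable M"
    using S_A by (rule measurable_compose)
  interpret N: prob_space "distr M N (\<lambda>\<omega>. \<omega>)"
    by (rule prob_space_distr) (rule id)
  interpret S: prob_space "distr M borel S"
    by (rule prob_space_distr) (rule S)
  show "distr M N (\<lambda>\<omega>. \<omega>) \<Otimes>\<^sub>M distr M borel S = distr M (N \<Otimes>\<^sub>M borel) (\<lambda>\<omega>. (\<omega>, S \<omega>))"
  proof (rule pair_measure_eqI)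
    fix A B assume "A \<in> sets (distr M N (\<lambda>\<omega>. \<omega>))" "B \<in> sets (distr M borel S)"
    then have A: "A \<in> sets N" and B [measurable]: "B \<in> sets borel"
      by auto
    have A_sub: "A \<subseteq> space M"
      using sets.sets_into_space[OF A] by (simp add: N_def)
    have "S -` B \<inter> space M \<in> sets ?A"
      using measurable_sets[OF S_A B] by simp
    then have "prob (A \<inter> (S -` B \<inter> space M)) = prob A * prob (S -` B \<inter> space M)"
      using A times_indep[OF assms(1)] unfolding N_def by (intro indep_setD) auto
    moreover have "(\<lambda>\<omega>. (\<omega>, S \<omega>)) -` (A \<times> B) \<inter> space M = A \<inter> (S -` B \<inter> space M)"
      by auto
    moreover have "(\<lambda>\<omega>. \<omega>) -` A \<inter> space M = A"
      using A_sub by auto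
    ultimately show "emeasure (distr M N (\<lambda>\<omega>. \<omega>)) A * emeasure (distr M borel S) B =
        emeasure (distr M (N \<Otimes>\<^sub>M borel) (\<lambda>\<omega>. (\<omega>, S \<omega>))) (A \<times> B)"
      using A B by (simp add: emeasure_distr emeasure_eq_measure ennreal_mult)
  qed (auto intro: N.sigma_finite_measure_axioms S.sigma_finite_measure_axioms)
qed

text \<open>By Fubini the epoch may be fixed first. At a fixed time the probability of an empty
  start factors out, and it cancels in the conditional probability.\<close>

lemma empty_prob_eq_integral:
  assumes "0 < \<xi>" "1 \<le> k" and V0: "0 < prob {\<omega> \<in> space M. V0 \<omega> = 0}"
  shows "empty_prob M J V0 T k \<xi> = (\<integral>t. erlang_density (k - 1) \<xi> t * idle_prob M J t \<partial>lborel)"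
proof -
  let ?S = "sampling_epoch (T \<xi>) k"
  let ?N = "vimage_algebra (space M) (\<lambda>\<omega>. (path J \<omega>, V0 \<omega>)) (path_space \<Otimes>\<^sub>M borel)"
  \<comment> \<open>The condition on \<open>V0\<close> stays inside the event, because the epochs
    are independent of path and initial workload jointly.\<close>
  define f :: "'a \<times> real \<Rightarrow> real" where "f = (\<lambda>(\<omega>, t). of_bool (reflected J (max 0 t) \<omega> = 0 \<and> V0 \<omega> = 0))"
  have pair: "(\<lambda>\<omega>. (path J \<omega>, V0 \<omega>)) \<in> measurable ?N (path_space \<Otimes>\<^sub>M borel)"
    by (rule measurable_vimage_algebra1) (auto simp: space_pair_measure space_PiM path_def)
  have J_N: "J s \<in> borel_measurable ?N" if "0 \<le> s" for s
  proof -
    have "(\<lambda>\<omega>. fst (path J \<omega>, V0 \<omega>) s) \<in> borel_measurable ?N"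
      using that
      by (intro measurable_compose[OF pair] measurable_compose[OF measurable_fst measurable_component_singleton]) auto
    then show ?thesis
      using that by (simp add: path_def)
  qed
  have [measurable]: "V0 \<in> borel_measurable ?N"
    using measurable_compose[OF pair measurable_snd] by simp
  have W: "(\<lambda>(\<omega>, t). reflected J (max 0 t) \<omega>) \<in> borel_measurable (?N \<Otimes>\<^sub>M borel)"
    by (rule measurable_reflected_pair[OF _ J_N]) auto
  have f_eq: "f = (\<lambda>p. of_bool ((\<lambda>(\<omega>, t). reflected J (max 0 t) \<omega>) p = 0 \<and> V0 (fst p) = 0))"
    by (auto simp: f_def)
  have [measurable]: "f \<in> borel_measurable (?N \<Otimes>\<^sub>M borel)"
    unfolding f_eq using W by measurable
  note id [measurable] = distr_path_epoch(1)[OF assms(1)]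
    and S [measurable] = distr_path_epoch(2)[OF assms(1), of k]
    and prod = distr_path_epoch(3)[OF assms(1), of k]
  have S_distr: "distr M borel ?S = density lborel (erlang_density (k - 1) \<xi>)"
    using sampling_epoch_distributed[OF assms(1,2)]
    by (simp add: distributed_def distr_cong[of M M borel lborel])
  let ?D = "distr M ?N (\<lambda>\<omega>. \<omega>)" and ?E = "distr M borel ?S"
  interpret D: prob_space ?D
    by (rule prob_space_distr) (rule id)
  interpret E: prob_space ?E
    by (rule prob_space_distr) (rule S)
  interpret DE: pair_prob_space ?D ?E ..
  have f_bound: "\<bar>f p\<bar> \<le> 1" for p
    by (auto simp: f_def split: prod.split)
  have "prob {\<omega> \<in> space M. sampled J V0 (T \<xi>) k \<omega> = 0 \<and> V0 \<omega> = 0} = expectation (\<lambda>\<omega>. f (\<omega>, ?S \<omega>))"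
  proof -
    let ?P = "\<lambda>\<omega>. reflected J (max 0 (?S \<omega>)) \<omega> = 0 \<and> V0 \<omega> = 0"
    have "{\<omega> \<in> space M. sampled J V0 (T \<xi>) k \<omega> = 0 \<and> V0 \<omega> = 0} = {\<omega> \<in> space M. ?P \<omega>}"
      using assms(1) by (auto simp: sampled_zero_iff)
    also have "{\<omega> \<in> space M. ?P \<omega>} = {\<omega> \<in> space M. f (\<omega>, ?S \<omega>) = 1}"
      by (auto simp: f_def)
    also have "\<dots> \<in> events"
      by measurable
    finally show ?thesis
      by (subst expectation_of_bool[symmetric]) (auto simp: f_def sampled_zero_iff assms(1) intro!: Bochner_Integration.integral_cong)
  qed
  also have "\<dots> = (\<integral>p. f p \<partial>distr M (?N \<Otimes>\<^sub>M borel) (\<lambda>\<omega>. (\<omega>, ?S \<omega>)))"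
    by (subst integral_distr) auto
  also have "\<dots> = (\<integral>p. f p \<partial>(?D \<Otimes>\<^sub>M ?E))"
    unfolding prod ..
  also have "\<dots> = (\<integral>t. \<integral>\<omega>. f (\<omega>, t) \<partial>?D \<partial>?E)"
  proof -
    have "integrable (?D \<Otimes>\<^sub>M ?E) f"
      using f_bound by (intro DE.integrable_const_bound[of _ 1]) auto
    then show ?thesis
      using DE.integral_snd[of "\<lambda>\<omega> t. f (\<omega>, t)"] by simp
  qed
  also have "\<dots> = (\<integral>t. expectation (\<lambda>\<omega>. f (\<omega>, t)) \<partial>?E)"
    by (simp add: integral_distr)
  also have "(\<lambda>t. expectation (\<lambda>\<omega>. f (\<omega>, t))) = (\<lambda>t. idle_prob M J t * prob {\<omega> \<in> space M. V0 \<omega> = 0})"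
  proof
    fix t
    have [measurable]: "reflected J (max 0 t) \<in> borel_measurable M" "V0 \<in> borel_measurable M"
      by (auto intro: measurable_reflected_M initial_measurable)
    have "expectation (\<lambda>\<omega>. f (\<omega>, t)) = prob {\<omega> \<in> space M. reflected J (max 0 t) \<omega> = 0 \<and> V0 \<omega> = 0}"
      unfolding f_def prod.case by (rule expectation_of_bool) measurable
    also have "\<dots> = idle_prob M J (max 0 t) * prob {\<omega> \<in> space M. V0 \<omega> = 0}"
      by (rule prob_idle_and_initially_empty) simp
    finally show "expectation (\<lambda>\<omega>. f (\<omega>, t)) = idle_prob M J t * prob {\<omega> \<in> space M. V0 \<omega> = 0}"
      by (simp add: idle_prob_def)
  qed
  also have "(\<integral>t. idle_prob M J t * prob {\<omega> \<in> space M. V0 \<omega> = 0} \<partial>?E) =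
      (\<integral>t. erlang_density (k - 1) \<xi> t * idle_prob M J t \<partial>lborel) * prob {\<omega> \<in> space M. V0 \<omega> = 0}"
    unfolding S_distr using assms by (simp add: integral_density)
  finally show ?thesis
    using V0 by (simp add: empty_prob_def cond_prob_def)
qed

text \<open>The Erlang density is a multiple of \<open>t ^ l * exp (- \<xi> * t)\<close> on the
  half-line; the power of \<open>- 1\<close> undoes the sign in \<open>(- t) ^ l\<close>.\<close>

lemma empty_prob_eq_laplace_moment:
  assumes "0 < \<xi>" "0 < prob {\<omega> \<in> space M. V0 \<omega> = 0}"
  shows "empty_prob M J V0 T (Suc l) \<xi> =
    (- 1) ^ l * \<xi> ^ Suc l / fact l * laplace_moment (idle_prob M J) l \<xi>"
proof -
  have "erlang_density l \<xi> t * idle_prob M J t = (- 1) ^ l * \<xi> ^ Suc l / fact l *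
      (indicator {0..} t * ((- t) ^ l * exp (- \<xi> * t) * idle_prob M J t))" for t
  proof -
    have "(- 1) ^ l * (- t) ^ l = t ^ l"
      by (simp flip: power_mult_distrib)
    then show ?thesis
      by (auto simp: erlang_density_def indicator_def mult_ac)
  qed
  then show ?thesis
    using empty_prob_eq_integral[of \<xi> "Suc l"] assms
    by (simp only: diff_Suc_1 laplace_moment_def) (subst integral_mult_right_zero, simp)
qed

end

text \<open>The part of summand \<open>l\<close> that contains \<open>F (l - 1)\<close> is the
  negative of the partial sum up to \<open>l - 1\<close>, so only the last \<open>F\<close>
  survives.\<close>

lemma sum_telescope_laplace:
  fixes F :: "nat \<Rightarrow> real"
  shows "(\<Sum>l\<le>n. (- \<xi>) ^ l / fact l * (\<xi> * F l + real l * F (l - 1))) =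
    (- 1) ^ n * \<xi> ^ Suc n / fact n * F n"
proof (induction n)
  case (Suc n)
  have "(- \<xi>) ^ Suc n / fact (Suc n) * real (Suc n) = - ((- 1) ^ n * \<xi> ^ Suc n / fact n)"
    by (simp add: power_minus[of \<xi>] fact_Suc divide_simps del: of_nat_Suc)
  moreover have "(- \<xi>) ^ Suc n * \<xi> = (- 1) ^ Suc n * \<xi> ^ Suc (Suc n)"
    by (subst power_minus) simp
  ultimately show ?case
    unfolding sum.atMost_Suc Suc.IH
    by (simp only: distrib_left diff_Suc_1 mult.assoc[symmetric] times_divide_eq_left) simp
qed simp

theorem proposition2:
  fixes M :: "'a measure" and J :: "real \<Rightarrow> 'a \<Rightarrow> real" and \<nu> :: "real measure"
    and V0 :: "'a \<Rightarrow> real" and T :: "real \<Rightarrow> nat \<Rightarrow> 'a \<Rightarrow> real" and \<xi> :: real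
  assumes "sampled_workload M J \<nu> V0 T"
    and "\<P>(\<omega> in M. V0 \<omega> = 0) > 0"
    and "\<xi> > 0"
  shows "smooth_at (empty_prob M J V0 T 1) \<xi> \<and>
    smooth_at (inverse_exponent M J) \<xi> \<and>
    smooth_at (\<lambda>x. 1 / inverse_exponent M J x) \<xi> \<and>
    (\<forall>k\<ge>1. empty_prob M J V0 T k \<xi> =
      (\<Sum>l=0..k-1. (- \<xi>) ^ l / fact l * (deriv ^^ l) (empty_prob M J V0 T 1) \<xi>)) \<and>
    (\<forall>l. (deriv ^^ l) (empty_prob M J V0 T 1) \<xi> =
      \<xi> * rho M J l \<xi> + (if l = 0 then 0 else real l * rho M J (l - 1) \<xi>)) \<and>
    (\<forall>l\<ge>1. rho M J l \<xi> =
      - (1 / inverse_exponent M J \<xi>) *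
        (\<Sum>m=0..l-1. real (l choose m) * rho M J m \<xi> * (deriv ^^ (l - m)) (inverse_exponent M J) \<xi>))"
proof -
  interpret sampled_workload M J \<nu> V0 T
    by (rule assms(1))
  let ?S = "{0<..} :: real set"
  let ?L = "laplace_moment (idle_prob M J)" and ?\<psi> = "inverse_exponent M J"
  let ?p = "empty_prob M J V0 T"
  have D: "(?L l has_real_derivative ?L (Suc l) x) (at x)" if "x \<in> ?S" for l x
    using that idle_prob_bounds by (intro DERIV_laplace_moment) auto
  have \<psi>L: "?\<psi> x * ?L 0 x = 1" if "x \<in> ?S" for x
    using that by (intro inverse_exponent_eq) auto
  have L_nz: "?L 0 x \<noteq> 0" and \<psi>_nz: "?\<psi> x \<noteq> 0" if "x \<in> ?S" for x
    using \<psi>L[OF that] by auto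
  have L_eq: "?L 0 x = 1 / ?\<psi> x" and \<psi>_eq: "inverse (?L 0 x) = ?\<psi> x" if "x \<in> ?S" for x
    using \<psi>L[OF that] L_nz[OF that] \<psi>_nz[OF that]
    by (simp_all add: eq_divide_eq inverse_eq_divide divide_eq_eq mult.commute)
  have L_smooth: "times_diff_on n (?L 0) ?S" for n
    by (rule times_diff_onI(1)[where D = ?L]) (auto simp: D)
  have \<psi>_smooth: "times_diff_on n ?\<psi> ?S" for n
    by (rule times_diff_on_cong[OF _ \<psi>_eq times_diff_on_inverse[OF _ L_smooth L_nz]]) auto
  have inv_smooth: "times_diff_on n (\<lambda>x. 1 / ?\<psi> x) ?S" for n
    by (rule times_diff_on_cong[OF _ L_eq L_smooth]) auto
  have p1: "?p 1 x = x * ?L 0 x" if "x \<in> ?S" for x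
    using empty_prob_eq_laplace_moment[of x 0] that assms(2) by simp
  have id_smooth: "times_diff_on n (\<lambda>x. x) ?S" for n
    by (rule times_diff_onI(1)[where D = "\<lambda>l x. if l = 0 then x else if l = 1 then 1 else 0"]) auto
  have p1_smooth: "times_diff_on n (?p 1) ?S" for n
    by (rule times_diff_on_cong[OF _ p1[symmetric] times_diff_on_mult[OF _ id_smooth L_smooth]]) auto
  have rho: "rho M J l \<xi> = ?L l \<xi>" for l
    unfolding rho_def
    by (rule times_diff_onI(2)[where S = ?S]) (use L_eq D \<open>\<xi> > 0\<close> in auto)
  have L_deriv: "(deriv ^^ l) (?L 0) \<xi> = ?L l \<xi>" for l
    by (rule times_diff_onI(2)[where S = ?S]) (use D \<open>\<xi> > 0\<close> in auto)
  \<comment> \<open>At \<open>l = 0\<close> the factor \<open>real l\<close> does the work of the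
    case distinction in the claim.\<close>
  have p1_deriv: "(deriv ^^ l) (?p 1) \<xi> = \<xi> * ?L l \<xi> + real l * ?L (l - 1) \<xi>" for l
    using deriv_funpow_cong[of ?S "?p 1" "\<lambda>x. x * ?L 0 x" \<xi> l] p1
      higher_deriv_id_mult[of ?S "?L 0" \<xi> l] L_smooth L_deriv \<open>\<xi> > 0\<close> by auto
  have smooth: "smooth_at f \<xi>" if "\<And>n. times_diff_on n f ?S" for f
    using that[of "Suc _"] \<open>\<xi> > 0\<close> by (auto simp: smooth_at_def times_diff_on_def)
  have pk: "?p k \<xi> = (\<Sum>l=0..k-1. (- \<xi>) ^ l / fact l * (deriv ^^ l) (?p 1) \<xi>)" if "1 \<le> k" for k
    using empty_prob_eq_laplace_moment[of \<xi> "k - 1"] that assms(2,3)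
      sum_telescope_laplace[of \<xi> "\<lambda>l. ?L l \<xi>" "k - 1"]
    unfolding p1_deriv atLeast0AtMost by simp
  have rec: "?L l \<xi> = - (1 / ?\<psi> \<xi>) *
      (\<Sum>m=0..l-1. real (l choose m) * ?L m \<xi> * (deriv ^^ (l - m)) ?\<psi> \<xi>)" if l_pos: "1 \<le> l" for l
  proof -
    obtain l' where l: "l = Suc l'"
      using l_pos by (cases l) auto
    have "(deriv ^^ l) (\<lambda>x. ?L 0 x * ?\<psi> x) \<xi> = (deriv ^^ l) (\<lambda>x. 1) \<xi>"
      by (rule deriv_funpow_cong[of ?S]) (use \<psi>L \<open>\<xi> > 0\<close> in \<open>auto simp: mult.commute\<close>)
    also have "\<dots> = 0"
      using times_diff_onI(2)[of ?S "\<lambda>x. 1" "\<lambda>l x. if l = 0 then 1 else 0" \<xi> l] \<open>\<xi> > 0\<close> l_pos by auto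
    finally have "(\<Sum>m\<le>l. real (l choose m) * ?L m \<xi> * (deriv ^^ (l - m)) ?\<psi> \<xi>) = 0"
      using higher_deriv_mult_real[of ?S "?L 0" ?\<psi> \<xi> l] L_smooth \<psi>_smooth L_deriv \<open>\<xi> > 0\<close> by auto
    \<comment> \<open>The summand \<open>m = l\<close> is the only one with \<psi> undifferentiated;
      it is isolated and then divided by \<psi>.\<close>
    then have "?L l \<xi> * ?\<psi> \<xi> = - (\<Sum>m\<le>l'. real (l choose m) * ?L m \<xi> * (deriv ^^ (l - m)) ?\<psi> \<xi>)"
      unfolding l by (simp add: eq_neg_iff_add_eq_0 add.commute del: binomial_Suc_Suc)
    then show ?thesis
      using \<psi>_nz[of \<xi>] \<open>\<xi> > 0\<close> by (simp add: l atLeast0AtMost field_simps del: binomial_Suc_Suc)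
  qed
  show ?thesis
    unfolding rho
    by (intro conjI allI impI smooth p1_smooth \<psi>_smooth inv_smooth pk rec) (simp_all add: p1_deriv del: One_nat_def)
qed

end
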